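(* Let $\mathbf{k}$ be a field, let $A$ be a (nonunitary associative) $\mathbf{k}$-algebra with a $\mathbf{k}$-basis $X$, and let the vector space $F_N(A)=\bigoplus_{\mathbf{x}\in\mathfrak{X}_\infty}\mathbf{k}\,\mathbf{x}$, the bilinear product $\diamond$ on $F_N(A)$, the linear operator $N_A:F_N(A)\to F_N(A)$, and the linear map $j_A:A\to F_N(A)$ be those constructed from $A$ and $X$ in the context. Then: (a) The pair $(F_N(A),\diamond)$ is an algebra (that is, $\diamond$ is associative). (b) The triple $(F_N(A),\diamond,N_A)$ is a Nijenhuis algebra. (c) The quadruple $(F_N(A),\diamond,N_A,j_A)$ is the free Nijenhuis algebra on the algebra $A$: $j_A$ is an algebra homomorphism and, for every Nijenhuis algebra $(N,P)$ and every algebra homomorphism $f:A\to N$, there is a unique Nijenhuis algebra homomorphism $\bar f:F_N(A)\to N$ such that $\bar f\circ j_A=f$.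
   Context: All algebras are over a field $\mathbf{k}$ and are nonunitary (not necessarily unital) associative. A Nijenhuis algebra is an algebra $N$ with a $\mathbf{k}$-linear endomorphism $P:N\to N$ satisfying $P(x)P(y)=P(P(x)y)+P(xP(y))-P^2(xy)$ for all $x,y\in N$. A Nijenhuis algebra homomorphism is an algebra homomorphism commuting with the operators. Construction of $F_N(A)$ for an algebra $A$ with $\mathbf{k}$-basis $X$. Bracketed words. Let $\lfloor,\rfloor$ be two symbols not in $X$, and let $M(X')$ be the free semigroup on $X'=X\cup\{\lfloor,\rfloor\}$. For subsets $Y,Z\subseteq M(X')$ let $\lfloor Z\rfloor=\{\lfloor z\rfloor: z\in Z\}$ and $$\Lambda(Y,Z)=\Big(\bigcup_{r\ge1}(Y\lfloor Z\rfloor)^r\Big)\cup\Big(\bigcup_{r\ge0}(Y\lfloor Z\rfloor)^rY\Big)\cup\Big(\bigcup_{r\ge1}(\lfloor Z\rfloor Y)^r\Big)\cup\Big(\bigcup_{r\ge0}(\lfloor Z\rfloor Y)^r\lfloor Z\rfloor\Big).$$ Set $\mathfrak{X}_0=X$, $\mathfrak{X}_{n+1}=\Lambda(X,\mathfrak{X}_n)$ for $n\ge0$; these are increasing, and $\mathfrak{X}_\infty=\bigcup_{n\ge0}\mathfrak{X}_n$. Every $\mathbf{x}\in\mathfrak{X}_\infty$ has a unique standard decomposition $\mathbf{x}=\mathbf{x}_1\cdots\mathbf{x}_b$ in which the $\mathbf{x}_i$ lie alternately in $X$ and in $\lfloor\mathfrak{X}_\infty\rfloor$; $b$ is the breadth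 of $\mathbf{x}$. The depth $d(\mathbf{x})$ is the smallest $n$ with $\mathbf{x}\in\mathfrak{X}_n$. Put $F_N(A)=\bigoplus_{\mathbf{x}\in\mathfrak{X}_\infty}\mathbf{k}\,\mathbf{x}$; identify $A=\bigoplus_{x\in X}\mathbf{k}x$ with a subspace of $F_N(A)$. Product. The bilinear product $\diamond$ on $F_N(A)$ is defined on basis words $\mathbf{x},\mathbf{x}'\in\mathfrak{X}_\infty$ by recursion on $d(\mathbf{x})+d(\mathbf{x}')$. If both have breadth one: - if $\mathbf{x},\mathbf{x}'\in X$, then $\mathbf{x}\diamond\mathbf{x}'$ is the product of $\mathbf{x}$ and $\mathbf{x}'$ in $A\subseteq F_N(A)$; - if exactly one of $\mathbf{x},\mathbf{x}'$ is in $X$ and the other in $\lfloor\mathfrak{X}_\infty\rfloor$, then $\mathbf{x}\diamond\mathbf{x}'=\mathbf{x}\mathbf{x}'$ (concatenation); - if $\mathbf{x}=\lfloor\bar{\mathbf{x}}\rfloor$ and $\mathbf{x}'=\lfloor\bar{\mathbf{x}}'\rfloor$, then $\mathbf{x}\diamond\mathbf{x}'=\lfloor\lfloor\bar{\mathbf{x}}\rfloor\diamond\bar{\mathbf{x}}'\rfloor+\lfloor\bar{\mathbf{x}}\diamond\lfloor\bar{\mathbf{x}}'\rfloor\rfloor-\lfloor\lfloor\bar{\mathbf{x}}\diamond\bar{\mathbf{x}}'\rfloor\rfloor$, where $\lfloor\cdot\rfloor$ is extended linearly. In general, for standard decompositions $\mathbf{x}=\mathbf{x}_1\cdots\mathbf{x}_b$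 and $\mathbf{x}'=\mathbf{x}'_1\cdots\mathbf{x}'_{b'}$, set $\mathbf{x}\diamond\mathbf{x}'=\mathbf{x}_1\cdots\mathbf{x}_{b-1}(\mathbf{x}_b\diamond\mathbf{x}'_1)\mathbf{x}'_2\cdots\mathbf{x}'_{b'}$, with $\mathbf{x}_b\diamond\mathbf{x}'_1$ as just defined and the rest being (linearly extended) concatenation. Operator and embedding. $N_A:F_N(A)\to F_N(A)$ is the linear map with $N_A(\mathbf{x})=\lfloor\mathbf{x}\rfloor$ for $\mathbf{x}\in\mathfrak{X}_\infty$. $j_A:A\to F_N(A)$ is the linear extension of the inclusion $X\hookrightarrow\mathfrak{X}_\infty$. *)

theory Defs
  imports Complex_Main "HOL-Library.Poly_Mapping" "HOL-Library.FuncSet"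
begin

section \<open>Nonunitary algebras and Nijenhuis algebras\<close>

text \<open>
  An algebra is carried by a subspace of an ambient vector space (possibly the whole type), as its
  multiplication is in general only well behaved there.
\<close>

locale nonunital_algebra = vector_space scale
  for scale :: "'k::field \<Rightarrow> 'v::ab_group_add \<Rightarrow> 'v" (infixr "*s" 75) +
  fixes carrier :: "'v set"
    and mult :: "'v \<Rightarrow> 'v \<Rightarrow> 'v" (infixl "\<cdot>" 70)
  assumes subspace_carrier: "subspace carrier"
    and mult_closed: "\<lbrakk>x \<in> carrier; y \<in> carrier\<rbrakk> \<Longrightarrow> x \<cdot> y \<in> carrier"
    and mult_add_left: "\<lbrakk>x \<in> carrier; y \<in> carrier; z \<in> carrier\<rbrakk> \<Longrightarrow> (x + y) \<cdot> z = x \<cdot> z + y \<cdot> z"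
    and mult_add_right: "\<lbrakk>x \<in> carrier; y \<in> carrier; z \<in> carrier\<rbrakk> \<Longrightarrow> x \<cdot> (y + z) = x \<cdot> y + x \<cdot> z"
    and mult_scale_left: "\<lbrakk>x \<in> carrier; y \<in> carrier\<rbrakk> \<Longrightarrow> (c *s x) \<cdot> y = c *s (x \<cdot> y)"
    and mult_scale_right: "\<lbrakk>x \<in> carrier; y \<in> carrier\<rbrakk> \<Longrightarrow> x \<cdot> (c *s y) = c *s (x \<cdot> y)"
    and mult_assoc: "\<lbrakk>x \<in> carrier; y \<in> carrier; z \<in> carrier\<rbrakk> \<Longrightarrow> (x \<cdot> y) \<cdot> z = x \<cdot> (y \<cdot> z)"

locale nijenhuis_algebra = nonunital_algebra scale carrier mult
  for scale :: "'k::field \<Rightarrow> 'v::ab_group_add \<Rightarrow> 'v" (infixr "*s" 75)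
    and carrier :: "'v set"
    and mult :: "'v \<Rightarrow> 'v \<Rightarrow> 'v" (infixl "\<cdot>" 70) +
  fixes P :: "'v \<Rightarrow> 'v"
  assumes P_closed: "x \<in> carrier \<Longrightarrow> P x \<in> carrier"
    and P_add: "\<lbrakk>x \<in> carrier; y \<in> carrier\<rbrakk> \<Longrightarrow> P (x + y) = P x + P y"
    and P_scale: "x \<in> carrier \<Longrightarrow> P (c *s x) = c *s P x"
    and nijenhuis: "\<lbrakk>x \<in> carrier; y \<in> carrier\<rbrakk>
      \<Longrightarrow> P x \<cdot> P y = P (P x \<cdot> y) + P (x \<cdot> P y) - P (P (x \<cdot> y))"

definition algebra_hom ::
  "('k \<Rightarrow> 'v::ab_group_add \<Rightarrow> 'v) \<Rightarrow> 'v set \<Rightarrow> ('v \<Rightarrow> 'v \<Rightarrow> 'v) \<Rightarrow>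
   ('k \<Rightarrow> 'w::ab_group_add \<Rightarrow> 'w) \<Rightarrow> 'w set \<Rightarrow> ('w \<Rightarrow> 'w \<Rightarrow> 'w) \<Rightarrow> ('v \<Rightarrow> 'w) \<Rightarrow> bool" where
  "algebra_hom sV V mV sW W mW f \<longleftrightarrow>
     (\<forall>x\<in>V. f x \<in> W) \<and>
     (\<forall>x\<in>V. \<forall>y\<in>V. f (x + y) = f x + f y) \<and>
     (\<forall>c. \<forall>x\<in>V. f (sV c x) = sW c (f x)) \<and>
     (\<forall>x\<in>V. \<forall>y\<in>V. f (mV x y) = mW (f x) (f y))"

definition nijenhuis_hom ::
  "('k \<Rightarrow> 'v::ab_group_add \<Rightarrow> 'v) \<Rightarrow> 'v set \<Rightarrow> ('v \<Rightarrow> 'v \<Rightarrow> 'v) \<Rightarrow> ('v \<Rightarrow> 'v) \<Rightarrow>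
   ('k \<Rightarrow> 'w::ab_group_add \<Rightarrow> 'w) \<Rightarrow> 'w set \<Rightarrow> ('w \<Rightarrow> 'w \<Rightarrow> 'w) \<Rightarrow> ('w \<Rightarrow> 'w) \<Rightarrow>
   ('v \<Rightarrow> 'w) \<Rightarrow> bool" where
  "nijenhuis_hom sV V mV PV sW W mW PW f \<longleftrightarrow>
     algebra_hom sV V mV sW W mW f \<and> (\<forall>x\<in>V. f (PV x) = PW (f x))"


section \<open>Bracketed words\<close>

text \<open>
  Elements of the free semigroup on the disjoint union of the letters and the two bracket
  symbols are nonempty lists; the empty list only occurs as the zeroth power in \<open>word_power\<close>.
\<close>

datatype 'a symb = Gen 'a | LBr | RBr

type_synonym 'a word = "'a symb list"

definition letters :: "'a set \<Rightarrow> 'a word set" where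
  "letters X = (\<lambda>x. [Gen x]) ` X"

definition bracket :: "'a word \<Rightarrow> 'a word" where
  "bracket w = LBr # w @ [RBr]"

definition unbracket :: "'a word \<Rightarrow> 'a word" where
  "unbracket w = butlast (tl w)"

definition word_conc :: "'a word set \<Rightarrow> 'a word set \<Rightarrow> 'a word set" where
  "word_conc Y Z = {y @ z | y z. y \<in> Y \<and> z \<in> Z}"

primrec word_power :: "'a word set \<Rightarrow> nat \<Rightarrow> 'a word set" where
  "word_power Y 0 = {[]}"
| "word_power Y (Suc r) = word_conc Y (word_power Y r)"

definition Lambda :: "'a word set \<Rightarrow> 'a word set \<Rightarrow> 'a word set" where
  "Lambda Y Z =
     (\<Union>r\<in>{1..}. word_power (word_conc Y (bracket ` Z)) r) \<union>
     (\<Union>r\<in>{0..}. word_conc (word_power (word_conc Y (bracket ` Z)) r) Y) \<union>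
     (\<Union>r\<in>{1..}. word_power (word_conc (bracket ` Z) Y) r) \<union>
     (\<Union>r\<in>{0..}. word_conc (word_power (word_conc (bracket ` Z) Y) r) (bracket ` Z))"

primrec bracketed_upto :: "'a set \<Rightarrow> nat \<Rightarrow> 'a word set" where
  "bracketed_upto X 0 = letters X"
| "bracketed_upto X (Suc n) = Lambda (letters X) (bracketed_upto X n)"

definition bracketed_words :: "'a set \<Rightarrow> 'a word set" where
  "bracketed_words X = (\<Union>n. bracketed_upto X n)"

definition is_std_decomp :: "'a set \<Rightarrow> 'a word \<Rightarrow> 'a word list \<Rightarrow> bool" where
  "is_std_decomp X w ws \<longleftrightarrow>
     ws \<noteq> [] \<and> concat ws = w \<and>
     set ws \<subseteq> letters X \<union> bracket ` bracketed_words X \<and>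
     successively (\<lambda>u v. (u \<in> letters X \<and> v \<in> bracket ` bracketed_words X) \<or>
                         (u \<in> bracket ` bracketed_words X \<and> v \<in> letters X)) ws"

definition std_decomp :: "'a set \<Rightarrow> 'a word \<Rightarrow> 'a word list" where
  "std_decomp X w = (THE ws. is_std_decomp X w ws)"

definition breadth :: "'a set \<Rightarrow> 'a word \<Rightarrow> nat" where
  "breadth X w = length (std_decomp X w)"


subsection \<open>Existence and uniqueness of the standard decomposition\<close>

definition balanced :: "'a word \<Rightarrow> bool" where
  "balanced w \<longleftrightarrow> count_list w LBr = count_list w RBr \<and>
     (\<forall>p q. w = p @ q \<longrightarrow> count_list p RBr \<le> count_list p LBr)"

lemma balanced_append:
  assumes "balanced u" "balanced v"
  shows "balanced (u @ v)"
  unfolding balanced_def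
proof (intro conjI allI impI)
  show "count_list (u @ v) LBr = count_list (u @ v) RBr"
    using assms by (simp add: balanced_def)
  fix p q assume "u @ v = p @ q"
  then consider us where "u = p @ us" | us where "p = u @ us" "v = us @ q"
    by (auto simp: append_eq_append_conv2)
  then show "count_list p RBr \<le> count_list p LBr"
    using assms by cases (auto simp: balanced_def)
qed

lemma balanced_Nil: "balanced []"
  by (simp add: balanced_def)

lemma balanced_Gen: "balanced [Gen x]"
  by (auto simp: balanced_def Cons_eq_append_conv)

lemma balanced_bracket:
  assumes "balanced u"
  shows "balanced (bracket u)"
  unfolding balanced_def
proof (intro conjI allI impI)
  show "count_list (bracket u) LBr = count_list (bracket u) RBr"
    using assms by (simp add: balanced_def bracket_def)
  fix p q assume "bracket u = p @ q"
  then consider "p = []" | p' where "p = LBr # p'" "u @ [RBr] = p' @ q"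
    by (auto simp: bracket_def Cons_eq_append_conv)
  then show "count_list p RBr \<le> count_list p LBr"
  proof cases
    case 2
    then consider us where "u = p' @ us" | "p' = u @ [RBr]"
      by (auto simp: append_eq_append_conv2 Cons_eq_append_conv append_eq_Cons_conv)
    then show ?thesis
      using assms 2(1) by cases (fastforce simp: balanced_def)+
  qed simp
qed

lemma balanced_word_conc:
  assumes "\<forall>y\<in>Y. balanced y" "\<forall>z\<in>Z. balanced z"
  shows "\<forall>w\<in>word_conc Y Z. balanced w"
  using assms by (auto simp: word_conc_def intro: balanced_append)

lemma balanced_word_power:
  assumes "\<forall>y\<in>Y. balanced y"
  shows "\<forall>w\<in>word_power Y r. balanced w"
proof (induction r)
  case 0
  show ?case by (simp add: balanced_Nil)
next
  case (Suc r)
  show ?case using balanced_word_conc[OF assms Suc.IH] by simp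
qed

lemma balanced_letters: "\<forall>y\<in>letters X. balanced y"
  by (auto simp: letters_def balanced_Gen)

lemma balanced_Lambda:
  assumes "\<forall>y\<in>Y. balanced y" "\<forall>z\<in>Z. balanced z"
  shows "\<forall>w\<in>Lambda Y Z. balanced w"
proof -
  have Z: "\<forall>z\<in>bracket ` Z. balanced z"
    using assms(2) by (auto intro: balanced_bracket)
  show ?thesis
    unfolding Lambda_def
    using balanced_word_power[OF balanced_word_conc[OF assms(1) Z]]
      balanced_word_conc[OF balanced_word_power[OF balanced_word_conc[OF assms(1) Z]] assms(1)]
      balanced_word_power[OF balanced_word_conc[OF Z assms(1)]]
      balanced_word_conc[OF balanced_word_power[OF balanced_word_conc[OF Z assms(1)]] Z]
    by blast
qed

lemma balanced_bracketed_words: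
  assumes "w \<in> bracketed_words X"
  shows "balanced w"
proof -
  have "\<forall>w\<in>bracketed_upto X n. balanced w" for n
  proof (induction n)
    case 0
    show ?case using balanced_letters by simp
  next
    case (Suc n)
    show ?case using balanced_Lambda[OF balanced_letters Suc.IH] by simp
  qed
  with assms show ?thesis
    by (auto simp: bracketed_words_def)
qed

lemma bracket_prefix_free:
  assumes "balanced u" "balanced v" "bracket u @ r = bracket v @ s"
  shows "u = v"
proof -
  have aux: False
    if "balanced a" "balanced b" "b = a @ RBr # t" for a b t :: "'a word"
  proof -
    have "b = (a @ [RBr]) @ t"
      using that(3) by simp
    then have "count_list (a @ [RBr]) RBr \<le> count_list (a @ [RBr]) LBr"
      using that(2) unfolding balanced_def by blast
    then show False
      using that(1) by (simp add: balanced_def)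
  qed
  have "u @ RBr # r = v @ RBr # s"
    using assms(3) by (simp add: bracket_def)
  then obtain us where "u = v @ us \<and> us @ RBr # r = RBr # s \<or> u @ us = v \<and> RBr # r = us @ RBr # s"
    by (auto simp: append_eq_append_conv2)
  then show ?thesis
    using aux[OF assms(1,2)] aux[OF assms(2,1)] by (cases us) auto
qed

lemma component_prefix_free:
  assumes "c \<in> letters X \<union> bracket ` bracketed_words X"
    and "d \<in> letters X \<union> bracket ` bracketed_words X"
    and "c @ r = d @ s"
  shows "c = d"
proof (cases "c \<in> letters X")
  case True
  with assms show ?thesis
    by (auto simp: letters_def bracket_def)
next
  case False
  then obtain u where u: "c = bracket u" "u \<in> bracketed_words X"
    using assms(1) by auto
  with assms(2,3) obtain v where v: "d = bracket v" "v \<in> bracketed_words X"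
    by (auto simp: letters_def bracket_def)
  show ?thesis
    using bracket_prefix_free[of u v r s] u v assms(3) balanced_bracketed_words by metis
qed

lemma component_nonempty:
  "c \<in> letters X \<union> bracket ` bracketed_words X \<Longrightarrow> c \<noteq> []"
  by (auto simp: letters_def bracket_def)

lemma concat_components_inj:
  assumes "set ws \<subseteq> letters X \<union> bracket ` bracketed_words X"
    and "set vs \<subseteq> letters X \<union> bracket ` bracketed_words X"
    and "concat ws = concat vs"
  shows "ws = vs"
  using assms
proof (induction ws arbitrary: vs)
  case Nil
  then show ?case
    using component_nonempty by (cases vs) auto
next
  case (Cons c ws)
  then obtain d vs' where vs: "vs = d # vs'"
    using component_nonempty by (cases vs) auto
  have "c = d"
    using component_prefix_free[of c X d "concat ws" "concat vs'"] Cons.prems vs by simp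
  then show ?case
    using Cons vs by simp
qed

lemma alternating_power:
  assumes "w \<in> word_power (word_conc A B) r" "r \<ge> 1"
  shows "\<exists>ws. ws \<noteq> [] \<and> concat ws = w \<and> set ws \<subseteq> A \<union> B \<and> hd ws \<in> A \<and> last ws \<in> B \<and>
           successively (\<lambda>u v. (u \<in> A \<and> v \<in> B) \<or> (u \<in> B \<and> v \<in> A)) ws"
  using assms
proof (induction r arbitrary: w)
  case (Suc r)
  then obtain a b v where w: "w = a @ b @ v" "a \<in> A" "b \<in> B" "v \<in> word_power (word_conc A B) r"
    by (auto simp: word_conc_def)
  show ?case
  proof (cases "r = 0")
    case True
    with w show ?thesis
      by (intro exI[of _ "[a, b]"]) auto
  next
    case False
    with Suc.IH[OF w(4)] obtain ws where
      "ws \<noteq> []" "concat ws = v" "set ws \<subseteq> A \<union> B" "hd ws \<in> A" "last ws \<in> B"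
      "successively (\<lambda>u v. (u \<in> A \<and> v \<in> B) \<or> (u \<in> B \<and> v \<in> A)) ws"
      by auto
    with w show ?thesis
      by (intro exI[of _ "a # b # ws"]) (auto simp: successively_Cons)
  qed
qed simp

lemma alternating_power_snoc:
  assumes "w \<in> word_conc (word_power (word_conc A B) r) A"
  shows "\<exists>ws. ws \<noteq> [] \<and> concat ws = w \<and> set ws \<subseteq> A \<union> B \<and>
           successively (\<lambda>u v. (u \<in> A \<and> v \<in> B) \<or> (u \<in> B \<and> v \<in> A)) ws"
proof -
  obtain p a where w: "w = p @ a" "p \<in> word_power (word_conc A B) r" "a \<in> A"
    using assms by (auto simp: word_conc_def)
  show ?thesis
  proof (cases "r = 0")
    case True
    with w show ?thesis
      by (intro exI[of _ "[a]"]) auto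
  next
    case False
    with alternating_power[OF w(2)] obtain ws where
      "ws \<noteq> []" "concat ws = p" "set ws \<subseteq> A \<union> B" "last ws \<in> B"
      "successively (\<lambda>u v. (u \<in> A \<and> v \<in> B) \<or> (u \<in> B \<and> v \<in> A)) ws"
      by auto
    with w show ?thesis
      by (intro exI[of _ "ws @ [a]"]) (auto simp: successively_append_iff)
  qed
qed

lemma ex_is_std_decomp:
  assumes "w \<in> bracketed_words X"
  shows "\<exists>ws. is_std_decomp X w ws"
proof -
  obtain n where "w \<in> bracketed_upto X n"
    using assms by (auto simp: bracketed_words_def)
  then show ?thesis
  proof (cases n)
    case 0
    with \<open>w \<in> bracketed_upto X n\<close> show ?thesis
      by (intro exI[of _ "[w]"]) (auto simp: is_std_decomp_def)
  next
    case (Suc m)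
    let ?A = "letters X" and ?B = "bracket ` bracketed_upto X m"
    have B: "?B \<subseteq> bracket ` bracketed_words X"
      by (auto simp: bracketed_words_def)
    have "w \<in> Lambda ?A (bracketed_upto X m)"
      using \<open>w \<in> bracketed_upto X n\<close> Suc by simp
    then consider r where "r \<ge> 1" "w \<in> word_power (word_conc ?A ?B) r"
      | r where "w \<in> word_conc (word_power (word_conc ?A ?B) r) ?A"
      | r where "r \<ge> 1" "w \<in> word_power (word_conc ?B ?A) r"
      | r where "w \<in> word_conc (word_power (word_conc ?B ?A) r) ?B"
      unfolding Lambda_def by auto
    then have "\<exists>ws. ws \<noteq> [] \<and> concat ws = w \<and> set ws \<subseteq> ?A \<union> ?B \<and>
           successively (\<lambda>u v. (u \<in> ?A \<and> v \<in> ?B) \<or> (u \<in> ?B \<and> v \<in> ?A)) ws"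
    proof cases
      case 1 then show ?thesis using alternating_power by blast
    next
      case 2 then show ?thesis using alternating_power_snoc by blast
    next
      case (3 r)
      from alternating_power[OF 3(2,1)] show ?thesis
        by (simp add: Un_commute disj_commute conj_commute) blast
    next
      case (4 r)
      from alternating_power_snoc[OF 4] show ?thesis
        by (simp add: Un_commute disj_commute conj_commute)
    qed
    then obtain ws where ws: "ws \<noteq> []" "concat ws = w" "set ws \<subseteq> ?A \<union> ?B"
      "successively (\<lambda>u v. (u \<in> ?A \<and> v \<in> ?B) \<or> (u \<in> ?B \<and> v \<in> ?A)) ws"
      by blast
    have "is_std_decomp X w ws"
      unfolding is_std_decomp_def
      using ws B by (auto intro!: successively_mono[OF ws(4)])
    then show ?thesis ..
  qed
qed

lemma is_std_decomp_unique:
  assumes "is_std_decomp X w ws" "is_std_decomp X w vs"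
  shows "ws = vs"
  using assms concat_components_inj[of ws X vs] by (simp add: is_std_decomp_def)

lemma is_std_decomp_std_decomp:
  assumes "w \<in> bracketed_words X"
  shows "is_std_decomp X w (std_decomp X w)"
  unfolding std_decomp_def
  using ex_is_std_decomp[OF assms] is_std_decomp_unique by (metis theI)

lemma length_le_std_decomp:
  assumes "w \<in> bracketed_words X" "c \<in> set (std_decomp X w)"
  shows "length c \<le> length w"
proof -
  have "w = concat (std_decomp X w)"
    using is_std_decomp_std_decomp[OF assms(1)] by (simp add: is_std_decomp_def)
  moreover obtain us vs where "std_decomp X w = us @ c # vs"
    using assms(2) by (meson split_list)
  ultimately have "w = concat us @ c @ concat vs"
    by (metis concat.simps(2) concat_append)
  then show ?thesis
    by simp
qed

lemma length_less_std_decomp: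
  assumes "w \<in> bracketed_words X" "c \<in> set (std_decomp X w)" "breadth X w \<noteq> 1"
  shows "length c < length w"
proof -
  let ?ws = "std_decomp X w"
  have d: "is_std_decomp X w ?ws"
    by (rule is_std_decomp_std_decomp[OF assms(1)])
  obtain us vs where ws: "?ws = us @ c # vs"
    using assms(2) by (meson split_list)
  have w: "w = concat us @ c @ concat vs"
    using d ws by (simp add: is_std_decomp_def)
  have ne: "x \<noteq> []" if "x \<in> set ?ws" for x
    using d that component_nonempty[of x X] unfolding is_std_decomp_def by blast
  have "us \<noteq> [] \<or> vs \<noteq> []"
    using assms(3) ws by (auto simp: breadth_def)
  then have "concat us \<noteq> [] \<or> concat vs \<noteq> []"
    using ne ws by (cases us; cases vs) auto
  then show ?thesis
    using w by auto
qed

lemma std_decomp_ends: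
  assumes "w \<in> bracketed_words X"
  shows "hd (std_decomp X w) \<in> set (std_decomp X w)" "last (std_decomp X w) \<in> set (std_decomp X w)"
  using is_std_decomp_std_decomp[OF assms] by (simp_all add: is_std_decomp_def)

lemma bracketed_words_nonempty:
  assumes "w \<in> bracketed_words X"
  shows "w \<noteq> []"
proof -
  have d: "is_std_decomp X w (std_decomp X w)"
    by (rule is_std_decomp_std_decomp[OF assms])
  then have "hd (std_decomp X w) \<noteq> []"
    using std_decomp_ends(1)[OF assms] component_nonempty unfolding is_std_decomp_def by blast
  then show ?thesis
    using length_le_std_decomp[OF assms std_decomp_ends(1)[OF assms]] by auto
qed

lemma length_unbracket: "length (unbracket w) = length w - 2"
  by (simp add: unbracket_def)


section \<open>The construction\<close>

definition word_scale :: "'k::field \<Rightarrow> ('a word \<Rightarrow>\<^sub>0 'k) \<Rightarrow> ('a word \<Rightarrow>\<^sub>0 'k)" where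
  "word_scale c u = Poly_Mapping.map ((*) c) u"

definition FN :: "'a set \<Rightarrow> ('a word \<Rightarrow>\<^sub>0 'k::field) set" where
  "FN X = {u. Poly_Mapping.keys u \<subseteq> bracketed_words X}"

definition basis_vec :: "'a word \<Rightarrow> ('a word \<Rightarrow>\<^sub>0 'k::field)" where
  "basis_vec w = Poly_Mapping.single w 1"

definition lin_ext :: "('a word \<Rightarrow> ('a word \<Rightarrow>\<^sub>0 'k::field)) \<Rightarrow> ('a word \<Rightarrow>\<^sub>0 'k) \<Rightarrow> ('a word \<Rightarrow>\<^sub>0 'k)" where
  "lin_ext g u = (\<Sum>w\<in>Poly_Mapping.keys u. word_scale (Poly_Mapping.lookup u w) (g w))"

definition NA :: "('a word \<Rightarrow>\<^sub>0 'k::field) \<Rightarrow> ('a word \<Rightarrow>\<^sub>0 'k)" where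
  "NA = lin_ext (\<lambda>w. basis_vec (bracket w))"

definition jA :: "('k::field \<Rightarrow> 'a::ab_group_add \<Rightarrow> 'a) \<Rightarrow> 'a set \<Rightarrow> 'a \<Rightarrow> ('a word \<Rightarrow>\<^sub>0 'k)" where
  "jA scale X a =
     (\<Sum>x | module.representation scale X a x \<noteq> 0.
        word_scale (module.representation scale X a x) (basis_vec [Gen x]))"

definition letter_of :: "'a word \<Rightarrow> 'a" where
  "letter_of w = (THE x. w = [Gen x])"

text \<open>
  The value of the product on words that are not bracketed words over \<open>X\<close> is irrelevant and set
  to 0. The recursion is the one on the sum of the depths, but its termination is established
  by the total length of the two words, which decreases as well. In the last case the words
  to the left of \<open>x\<^sub>b\<close> and to the right of \<open>x'\<^sub>1\<close> may be empty.
\<close>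

context
  fixes scale :: "'k::field \<Rightarrow> 'a::ab_group_add \<Rightarrow> 'a"
    and mult :: "'a \<Rightarrow> 'a \<Rightarrow> 'a"
    and X :: "'a set"
begin

function word_prod :: "'a word \<Rightarrow> 'a word \<Rightarrow> ('a word \<Rightarrow>\<^sub>0 'k)" where
  "word_prod x x' =
     (if x \<notin> bracketed_words X \<or> x' \<notin> bracketed_words X then 0
      else if breadth X x = 1 \<and> breadth X x' = 1 then
        (if x \<in> letters X \<and> x' \<in> letters X then
           jA scale X (mult (letter_of x) (letter_of x'))
         else if x \<in> letters X \<or> x' \<in> letters X then
           basis_vec (x @ x')
         else
           NA (word_prod x (unbracket x')) + NA (word_prod (unbracket x) x')
           - NA (NA (word_prod (unbracket x) (unbracket x'))))
      else
        lin_ext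
          (\<lambda>w. basis_vec (concat (butlast (std_decomp X x)) @ w @ concat (tl (std_decomp X x'))))
          (word_prod (last (std_decomp X x)) (hd (std_decomp X x'))))"
  by pat_completeness auto
termination
proof (relation "measure (\<lambda>(x, x'). length x + length x')", goal_cases)
  case 1
  show ?case by simp
next
  case (2 x x')
  then show ?case
    using bracketed_words_nonempty by (cases x') (auto simp: length_unbracket)
next
  case (3 x x')
  then show ?case
    using bracketed_words_nonempty by (cases x) (auto simp: length_unbracket)
next
  case (4 x x')
  then show ?case
    using bracketed_words_nonempty by (cases x) (auto simp: length_unbracket)
next
  case (5 x x')
  then have x: "x \<in> bracketed_words X" "x' \<in> bracketed_words X" by auto
  have "length (last (std_decomp X x)) < length x \<or> length (hd (std_decomp X x')) < length x'"
    using 5 length_less_std_decomp[OF x(1) std_decomp_ends(2)[OF x(1)]]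
      length_less_std_decomp[OF x(2) std_decomp_ends(1)[OF x(2)]] by blast
  then show ?case
    using length_le_std_decomp[OF x(1) std_decomp_ends(2)[OF x(1)]]
      length_le_std_decomp[OF x(2) std_decomp_ends(1)[OF x(2)]] by auto
qed

declare word_prod.simps [simp del]

definition diamond :: "('a word \<Rightarrow>\<^sub>0 'k) \<Rightarrow> ('a word \<Rightarrow>\<^sub>0 'k) \<Rightarrow> ('a word \<Rightarrow>\<^sub>0 'k)" where
  "diamond u v =
     (\<Sum>x\<in>Poly_Mapping.keys u. \<Sum>x'\<in>Poly_Mapping.keys v.
        word_scale (Poly_Mapping.lookup u x * Poly_Mapping.lookup v x') (word_prod x x'))"

end

end

theory Submission
  imports Defs
begin

text \<open>
  The product only acts at the junction of two words, so it commutes with prepending a component to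
  the left factor and appending one to the right factor. Associativity follows by induction on the
  total length: outer components are peeled off until three components remain, where the only
  substantial case, three brackets, is a computation with the Nijenhuis identity. The extension of a
  homomorphism is forced on letters, brackets and concatenations, and this recursion defines it; that
  it is multiplicative follows by the same peeling.
\<close>

section \<open>Bracketed words\<close>

text \<open>The obstacle is that a product of two words is a sum of words, and every summand must
  still alternate with the neighbours that were split off. Letters times letters give combinations
  of letters, and brackets times brackets give combinations of brackets, so the kinds of the
  outermost components survive multiplication. These kinds are visible in the first and last symbol
  of a word, which makes alternation a test on symbols rather than on standard decompositions.
  Length, not depth, drives the inductions: splitting off a component need not lower the depth,
  whereas both this and the removal of brackets shorten the word. The Nijenhuis identity on words is
  the defining clause of the product on brackets, so the weight of the result lies in
  associativity.\<close>

definition is_letter :: "'a symb \<Rightarrow> bool" where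
  "is_letter s \<longleftrightarrow> (\<exists>x. s = Gen x)"

lemma is_letter_simps [simp]: "is_letter (Gen x)" "\<not> is_letter LBr" "\<not> is_letter RBr"
  by (auto simp: is_letter_def)

text \<open>For bracketed words \<open>u\<close> and \<open>v\<close>, this says that \<open>u @ v\<close> alternates at the junction.\<close>

definition joinable :: "'a word \<Rightarrow> 'a word \<Rightarrow> bool" where
  "joinable u v \<longleftrightarrow> is_letter (last u) \<noteq> is_letter (hd v)"

lemma hd_bracket [simp]: "hd (bracket w) = LBr"
  and last_bracket [simp]: "last (bracket w) = RBr"
  and bracket_neq_Nil [simp]: "bracket w \<noteq> []"
  and bracket_neq_Gen [simp]: "bracket w \<noteq> [Gen x]"
  and Gen_neq_bracket [simp]: "[Gen x] \<noteq> bracket w"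
  and unbracket_bracket [simp]: "unbracket (bracket w) = w"
  and length_bracket [simp]: "length (bracket w) = length w + 2"
  by (auto simp: bracket_def unbracket_def)

lemma letter_of_Gen [simp]: "letter_of [Gen x] = x"
  by (simp add: letter_of_def)

lemma Gen_in_letters [simp]: "[Gen x] \<in> letters X \<longleftrightarrow> x \<in> X"
  and bracket_notin_letters [simp]: "bracket w \<notin> letters X"
  by (auto simp: letters_def bracket_def)

section \<open>Monotonicity of the levels, and bracketed words from alternating lists\<close>

lemma word_conc_mono: "Y \<subseteq> Y' \<Longrightarrow> Z \<subseteq> Z' \<Longrightarrow> word_conc Y Z \<subseteq> word_conc Y' Z'"
  by (auto simp: word_conc_def)

lemma word_power_mono: "Y \<subseteq> Y' \<Longrightarrow> word_power Y r \<subseteq> word_power Y' r"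
  by (induction r) (simp_all add: word_conc_mono)

lemma Lambda_mono:
  assumes "Z \<subseteq> Z'"
  shows "Lambda Y Z \<subseteq> Lambda Y Z'"
proof -
  have B: "bracket ` Z \<subseteq> bracket ` Z'"
    using assms by blast
  show ?thesis
    unfolding Lambda_def
    by (intro Un_mono UN_mono word_power_mono word_conc_mono B order_refl)
qed

lemma subset_Lambda: "Y \<subseteq> Lambda Y Z"
proof -
  have "Y = word_conc (word_power (word_conc Y (bracket ` Z)) 0) Y"
    by (simp add: word_conc_def)
  then show ?thesis
    unfolding Lambda_def by blast
qed

lemma mono_bracketed_upto: "mono (bracketed_upto X)"
proof (rule mono_iff_le_Suc[THEN iffD2], rule allI)
  fix n show "bracketed_upto X n \<subseteq> bracketed_upto X (Suc n)"
    by (induction n) (simp_all add: subset_Lambda Lambda_mono)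
qed

lemma alternating_concat_in_power:
  assumes "A \<inter> B = {}" "set ws \<subseteq> A \<union> B" "ws = [] \<or> hd ws \<in> A"
    and "successively (\<lambda>u v. (u \<in> A \<and> v \<in> B) \<or> (u \<in> B \<and> v \<in> A)) ws"
  shows "concat ws \<in> (\<Union>r. word_power (word_conc A B) r) \<union>
           (\<Union>r. word_conc (word_power (word_conc A B) r) A)"
  using assms
proof (induction ws rule: induct_list012)
  case 1
  have "[] \<in> word_power (word_conc A B) 0"
    by simp
  then show ?case
    by (metis UN_I UNIV_I UnI1 concat.simps(1))
next
  case (2 a)
  then have "a \<in> word_conc (word_power (word_conc A B) 0) A"
    by (simp add: word_conc_def)
  then show ?case
    by (simp del: word_power.simps) blast
next
  case (3 a b ws)
  then have ab: "a @ b \<in> word_conc A B"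
    by (auto simp: word_conc_def)
  have "concat ws \<in> (\<Union>r. word_power (word_conc A B) r) \<union>
           (\<Union>r. word_conc (word_power (word_conc A B) r) A)"
    using 3 by (intro "3.IH"(1)) (auto simp: successively_Cons)
  then consider r where "concat ws \<in> word_power (word_conc A B) r"
    | r where "concat ws \<in> word_conc (word_power (word_conc A B) r) A"
    by blast
  then show ?case
  proof cases
    case 1
    with ab have "(a @ b) @ concat ws \<in> word_power (word_conc A B) (Suc r)"
      unfolding word_power.simps word_conc_def by blast
    then show ?thesis
      by (simp del: word_power.simps) blast
  next
    case 2
    then obtain p q where "concat ws = p @ q" "p \<in> word_power (word_conc A B) r" "q \<in> A"
      by (auto simp: word_conc_def)
    with ab have "(a @ b) @ p \<in> word_power (word_conc A B) (Suc r)"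
      unfolding word_power.simps word_conc_def by blast
    with \<open>q \<in> A\<close> have "((a @ b) @ p) @ q \<in> word_conc (word_power (word_conc A B) (Suc r)) A"
      unfolding word_conc_def by blast
    with \<open>concat ws = p @ q\<close> show ?thesis
      by (simp del: word_power.simps) blast
  qed
qed

text \<open>The introduction rule for bracketed words: closure under brackets and alternating
  concatenation follows from it without returning to the levels. Finitely many components fit into a
  single level \<open>n\<close>, so their alternating concatenation lies in level
  \<open>n + 1\<close>.\<close>

lemma bracketed_words_if_is_std_decomp:
  assumes "is_std_decomp X w ws"
  shows "w \<in> bracketed_words X"
proof -
  let ?B = "\<lambda>n. bracket ` bracketed_upto X n"
  have ws: "ws \<noteq> []" "concat ws = w" "set ws \<subseteq> letters X \<union> bracket ` bracketed_words X"
    using assms by (auto simp: is_std_decomp_def)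
  have ne: "w \<noteq> []"
  proof (cases ws)
    case (Cons c vs)
    then have "c \<noteq> []"
      using ws(3) by (intro component_nonempty) auto
    then show ?thesis
      using ws(2) Cons by auto
  qed (use ws(1) in simp)
  \<comment> \<open>Levels increase, so the maximum of the levels of finitely many components serves
    all of them.\<close>
  have "\<exists>n. set vs \<subseteq> letters X \<union> ?B n" if "set vs \<subseteq> letters X \<union> bracket ` bracketed_words X" for vs
    using that
  proof (induction vs)
    case (Cons v vs)
    from Cons.prems have "set vs \<subseteq> letters X \<union> bracket ` bracketed_words X"
      by simp
    with Cons.IH obtain n where n: "set vs \<subseteq> letters X \<union> ?B n"
      by blast
    from Cons.prems have "v \<in> letters X \<union> bracket ` bracketed_words X"
      by simp
    then obtain m where m: "v \<in> letters X \<union> ?B m"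
      unfolding bracketed_words_def image_UN by blast
    have "bracketed_upto X n \<subseteq> bracketed_upto X (max n m)" "bracketed_upto X m \<subseteq> bracketed_upto X (max n m)"
      by (simp_all add: monoD[OF mono_bracketed_upto])
    with n m show ?case
      by (intro exI[of _ "max n m"]) (simp, blast)
  qed simp
  then obtain n where n: "set ws \<subseteq> letters X \<union> ?B n"
    using ws(3) by blast
  have disj: "letters X \<inter> ?B n = {}"
    by auto
  \<comment> \<open>A component known only as a bracket of some bracketed word is not a letter,
    hence it is a bracket of level \<open>n\<close>.\<close>
  have succ: "successively (\<lambda>u v. (u \<in> letters X \<and> v \<in> ?B n) \<or> (u \<in> ?B n \<and> v \<in> letters X)) ws"
  proof (rule successively_mono)
    show "successively (\<lambda>u v. (u \<in> letters X \<and> v \<in> bracket ` bracketed_words X) \<or>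
        (u \<in> bracket ` bracketed_words X \<and> v \<in> letters X)) ws"
      using assms by (simp add: is_std_decomp_def)
    fix u v assume "u \<in> set ws" "v \<in> set ws"
      and "(u \<in> letters X \<and> v \<in> bracket ` bracketed_words X) \<or>
        (u \<in> bracket ` bracketed_words X \<and> v \<in> letters X)"
    moreover have "z \<notin> letters X" if "z \<in> bracket ` bracketed_words X" for z
      using that by auto
    moreover have "z \<in> letters X \<or> z \<in> ?B n" if "z \<in> set ws" for z
      using subsetD[OF n that] by (simp only: Un_iff)
    ultimately show "(u \<in> letters X \<and> v \<in> ?B n) \<or> (u \<in> ?B n \<and> v \<in> letters X)"
      by metis
  qed
  \<comment> \<open>Two of the unions in \<open>Lambda\<close> start at exponent 1; exponent 0
    contributes only the empty word.\<close>
  have pos: "w \<in> (\<Union>r\<in>{1..}. word_power Y r)" if "w \<in> (\<Union>r. word_power Y r)" for Y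
  proof -
    from that obtain r where "w \<in> word_power Y r"
      by blast
    moreover from this have "r \<in> {1..}"
      using ne by (cases r) auto
    ultimately show ?thesis
      by blast
  qed
  have "w \<in> Lambda (letters X) (bracketed_upto X n)"
  proof (cases "hd ws \<in> letters X")
    case True
    with alternating_concat_in_power[OF disj n _ succ] ws(2)
    have "w \<in> (\<Union>r. word_power (word_conc (letters X) (?B n)) r) \<union>
        (\<Union>r. word_conc (word_power (word_conc (letters X) (?B n)) r) (letters X))"
      by simp
    then show ?thesis
      unfolding Lambda_def atLeast_0 Un_iff using pos[of "word_conc (letters X) (?B n)"] by metis
  next
    case False
    then have "hd ws \<in> ?B n"
      using n ws(1) by (cases ws) auto
    moreover have "?B n \<inter> letters X = {}" "set ws \<subseteq> ?B n \<union> letters X"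
      using disj n by (simp_all only: Int_commute Un_commute)
    moreover have "successively (\<lambda>u v. (u \<in> ?B n \<and> v \<in> letters X) \<or> (u \<in> letters X \<and> v \<in> ?B n)) ws"
      using succ by (simp only: disj_commute)
    ultimately have "w \<in> (\<Union>r. word_power (word_conc (?B n) (letters X)) r) \<union>
        (\<Union>r. word_conc (word_power (word_conc (?B n) (letters X)) r) (?B n))"
      using alternating_concat_in_power[of "?B n" "letters X" ws] ws(2) by blast
    then show ?thesis
      unfolding Lambda_def atLeast_0 Un_iff using pos[of "word_conc (?B n) (letters X)"] by argo
  qed
  then show ?thesis
    unfolding bracketed_words_def by (metis UN_I UNIV_I bracketed_upto.simps(2))
qed

section \<open>Standard decompositions of letters, brackets and alternating concatenations\<close>

lemma std_decomp_eqI: "is_std_decomp X w ws \<Longrightarrow> std_decomp X w = ws"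
  unfolding std_decomp_def by (rule the_equality) (simp_all add: is_std_decomp_unique)

lemma is_std_decomp_letter: "x \<in> X \<Longrightarrow> is_std_decomp X [Gen x] [[Gen x]]"
  by (simp add: is_std_decomp_def)

lemma is_std_decomp_bracket: "w \<in> bracketed_words X \<Longrightarrow> is_std_decomp X (bracket w) [bracket w]"
  by (simp add: is_std_decomp_def)

text \<open>Both lists alternate already, so only the junction needs checking; the kinds of the
  components that meet there are read off the last symbol of \<open>u\<close> and the first symbol
  of \<open>v\<close>.\<close>

lemma is_std_decomp_append:
  assumes "is_std_decomp X u us" "is_std_decomp X v vs" "joinable u v"
  shows "is_std_decomp X (u @ v) (us @ vs)"
proof -
  let ?C = "letters X \<union> bracket ` bracketed_words X"
  have us: "us \<noteq> []" "concat us = u" "set us \<subseteq> ?C" and vs: "vs \<noteq> []" "concat vs = v" "set vs \<subseteq> ?C"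
    using assms by (auto simp: is_std_decomp_def)
  obtain us' c where c: "us = us' @ [c]" "c \<in> ?C"
    using us by (cases us rule: rev_cases) auto
  obtain vs' d where d: "vs = d # vs'" "d \<in> ?C"
    using vs by (cases vs) auto
  have "joinable c d"
    using assms(3) us(2) vs(2) c d component_nonempty[OF c(2)] component_nonempty[OF d(2)]
    by (auto simp: joinable_def)
  then have "(c \<in> letters X \<and> d \<in> bracket ` bracketed_words X) \<or>
      (c \<in> bracket ` bracketed_words X \<and> d \<in> letters X)"
    using c(2) d(2) by (auto simp: letters_def joinable_def)
  then show ?thesis
    using assms(1,2) c(1) d(1) by (auto simp: is_std_decomp_def successively_append_iff)
qed

lemma letter_in_bracketed_words: "x \<in> X \<Longrightarrow> [Gen x] \<in> bracketed_words X"
  by (rule bracketed_words_if_is_std_decomp[OF is_std_decomp_letter])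

lemma bracket_in_bracketed_words: "w \<in> bracketed_words X \<Longrightarrow> bracket w \<in> bracketed_words X"
  by (rule bracketed_words_if_is_std_decomp[OF is_std_decomp_bracket])

lemma append_in_bracketed_words:
  assumes "u \<in> bracketed_words X" "v \<in> bracketed_words X" "joinable u v"
  shows "u @ v \<in> bracketed_words X"
  using assms by (blast intro: bracketed_words_if_is_std_decomp[OF is_std_decomp_append]
      is_std_decomp_std_decomp)

lemma std_decomp_letter: "x \<in> X \<Longrightarrow> std_decomp X [Gen x] = [[Gen x]]"
  by (intro std_decomp_eqI is_std_decomp_letter)

lemma std_decomp_bracket: "w \<in> bracketed_words X \<Longrightarrow> std_decomp X (bracket w) = [bracket w]"
  by (intro std_decomp_eqI is_std_decomp_bracket)

lemma std_decomp_append: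
  assumes "u \<in> bracketed_words X" "v \<in> bracketed_words X" "joinable u v"
  shows "std_decomp X (u @ v) = std_decomp X u @ std_decomp X v"
  by (rule std_decomp_eqI[OF is_std_decomp_append[OF is_std_decomp_std_decomp[OF assms(1)]
      is_std_decomp_std_decomp[OF assms(2)] assms(3)]])

lemma concat_std_decomp: "w \<in> bracketed_words X \<Longrightarrow> concat (std_decomp X w) = w"
  and std_decomp_neq_Nil: "w \<in> bracketed_words X \<Longrightarrow> std_decomp X w \<noteq> []"
  and set_std_decomp: "w \<in> bracketed_words X \<Longrightarrow>
    set (std_decomp X w) \<subseteq> letters X \<union> bracket ` bracketed_words X"
  using is_std_decomp_std_decomp[of w X] by (simp_all add: is_std_decomp_def)

lemma bracketed_words_component_cases:
  assumes "c \<in> letters X \<union> bracket ` bracketed_words X"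
  obtains (letter) x where "x \<in> X" "c = [Gen x]"
    | (bracket) v where "v \<in> bracketed_words X" "c = bracket v"
  using assms by (auto simp: letters_def)

lemma component_in_bracketed_words:
  "c \<in> letters X \<union> bracket ` bracketed_words X \<Longrightarrow> c \<in> bracketed_words X"
  by (elim bracketed_words_component_cases)
    (simp_all add: letter_in_bracketed_words bracket_in_bracketed_words)

lemma std_decomp_component:
  "c \<in> letters X \<union> bracket ` bracketed_words X \<Longrightarrow> std_decomp X c = [c]"
  by (elim bracketed_words_component_cases) (simp_all add: std_decomp_letter std_decomp_bracket)

text \<open>The structural case rule behind the later inductions on length. In the third case both
  parts are strictly shorter than \<open>w\<close>, since components and bracketed words are
  nonempty.\<close>

lemma bracketed_words_cases [consumes 1, case_names letter bracket append]:
  assumes "w \<in> bracketed_words X"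
  obtains (letter) x where "x \<in> X" "w = [Gen x]"
    | (bracket) v where "v \<in> bracketed_words X" "w = bracket v"
    | (append) c v where "c \<in> letters X \<union> bracket ` bracketed_words X" "v \<in> bracketed_words X"
        "joinable c v" "w = c @ v"
proof -
  have d: "is_std_decomp X w (std_decomp X w)"
    by (rule is_std_decomp_std_decomp[OF assms])
  then obtain c vs where cvs: "std_decomp X w = c # vs" and C: "c \<in> letters X \<union> bracket ` bracketed_words X"
    unfolding is_std_decomp_def by (cases "std_decomp X w") auto
  show thesis
  proof (cases vs)
    case Nil
    with cvs d have "w = c"
      by (simp add: is_std_decomp_def)
    with C show ?thesis
      using letter bracket by (metis bracketed_words_component_cases)
  next
    case (Cons e vs')
    with d cvs have v: "is_std_decomp X (concat vs) vs"
      by (simp add: is_std_decomp_def)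
    have e: "e \<in> letters X \<union> bracket ` bracketed_words X"
        "(c \<in> letters X \<and> e \<in> bracket ` bracketed_words X) \<or>
         (c \<in> bracket ` bracketed_words X \<and> e \<in> letters X)"
      using d cvs Cons by (auto simp: is_std_decomp_def)
    have "joinable c (concat vs)"
      using e(2) Cons by (auto simp: letters_def joinable_def)
    then show ?thesis
      using append[OF C bracketed_words_if_is_std_decomp[OF v]] d cvs by (simp add: is_std_decomp_def)
  qed
qed

lemma joinable_append_left [simp]: "v \<noteq> [] \<Longrightarrow> joinable (u @ v) w = joinable v w"
  and joinable_append_right [simp]: "v \<noteq> [] \<Longrightarrow> joinable u (v @ w) = joinable u v"
  by (simp_all add: joinable_def)

section \<open>Linear and bilinear extension from words\<close>

lemma lookup_word_scale [simp]: "Poly_Mapping.lookup (word_scale c u) w = c * Poly_Mapping.lookup u w"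
  unfolding word_scale_def by transfer (simp add: when_def)

lemma lookup_basis_vec: "Poly_Mapping.lookup (basis_vec w) v = (if w = v then 1 else 0)"
  by (simp add: basis_vec_def lookup_single when_def)

lemma keys_basis_vec [simp]: "Poly_Mapping.keys (basis_vec w :: 'a word \<Rightarrow>\<^sub>0 'k::field) = {w}"
  by (simp add: basis_vec_def)

lemma keys_word_scale: "Poly_Mapping.keys (word_scale c u) \<subseteq> Poly_Mapping.keys u"
  by (auto simp: in_keys_iff)

lemma vector_space_word_scale: "vector_space (word_scale :: 'k::field \<Rightarrow> ('a word \<Rightarrow>\<^sub>0 'k) \<Rightarrow> _)"
  by unfold_locales (auto intro!: poly_mapping_eqI simp: lookup_add algebra_simps)

text \<open>\<open>lin_ext\<close> with an arbitrary vector space as target, as needed for extending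
  a homomorphism from words to \<open>FN X\<close>.\<close>

definition lin_comb ::
  "('k::field \<Rightarrow> 'v::ab_group_add \<Rightarrow> 'v) \<Rightarrow> ('a word \<Rightarrow> 'v) \<Rightarrow> ('a word \<Rightarrow>\<^sub>0 'k) \<Rightarrow> 'v" where
  "lin_comb s g u = (\<Sum>w\<in>Poly_Mapping.keys u. s (Poly_Mapping.lookup u w) (g w))"

context vector_space
begin

text \<open>The support of a sum is only contained in the union of the supports; summing over a
  common finite superset makes additivity a termwise identity.\<close>

lemma lin_comb_superset:
  assumes "finite S" "Poly_Mapping.keys u \<subseteq> S"
  shows "lin_comb scale g u = (\<Sum>w\<in>S. scale (Poly_Mapping.lookup u w) (g w))"
  unfolding lin_comb_def using assms
  by (intro sum.mono_neutral_left) (auto simp: in_keys_iff)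

lemma lin_comb_add: "lin_comb scale g (u + v) = lin_comb scale g u + lin_comb scale g v"
proof -
  let ?S = "Poly_Mapping.keys u \<union> Poly_Mapping.keys v"
  have "finite ?S" "Poly_Mapping.keys (u + v) \<subseteq> ?S"
    by (simp_all add: Poly_Mapping.keys_add)
  then show ?thesis
    by (simp add: lin_comb_superset[of ?S] lookup_add scale_left_distrib sum.distrib)
qed

lemma lin_comb_word_scale: "lin_comb scale g (word_scale c u) = scale c (lin_comb scale g u)"
  by (simp add: lin_comb_superset[of "Poly_Mapping.keys u"] keys_word_scale scale_sum_right)

lemma lin_comb_basis_vec [simp]: "lin_comb scale g (basis_vec w) = g w"
  by (simp add: lin_comb_def lookup_basis_vec)

lemma lin_comb_zero [simp]: "lin_comb scale g 0 = 0"
  by (simp add: lin_comb_def)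

lemma lin_comb_diff: "lin_comb scale g (u - v) = lin_comb scale g u - lin_comb scale g v"
  using lin_comb_add[of g "u - v" v] by simp

lemma lin_comb_fun_add: "lin_comb scale (\<lambda>w. g w + h w) u = lin_comb scale g u + lin_comb scale h u"
  by (simp add: lin_comb_def scale_right_distrib sum.distrib)

lemma lin_comb_fun_scale: "lin_comb scale (\<lambda>w. scale c (g w)) u = scale c (lin_comb scale g u)"
  by (simp add: lin_comb_def scale_sum_right mult.commute)

lemma lin_comb_in_subspace:
  "subspace S \<Longrightarrow> (\<And>w. w \<in> Poly_Mapping.keys u \<Longrightarrow> g w \<in> S) \<Longrightarrow> lin_comb scale g u \<in> S"
  unfolding lin_comb_def by (intro subspace_sum subspace_scale)

end

interpretation word_space: vector_space word_scale
  by (rule vector_space_word_scale)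

lemma lin_ext_eq_lin_comb: "lin_ext = lin_comb word_scale"
  by (intro ext) (simp add: lin_ext_def lin_comb_def)

lemma lin_ext_add: "lin_ext g (u + v) = lin_ext g u + lin_ext g v"
  and lin_ext_diff: "lin_ext g (u - v) = lin_ext g u - lin_ext g v"
  and lin_ext_scale: "lin_ext g (word_scale c u) = word_scale c (lin_ext g u)"
  and lin_ext_zero: "lin_ext g 0 = 0"
  and lin_ext_basis_vec: "lin_ext g (basis_vec w) = g w"
  by (simp_all add: lin_ext_eq_lin_comb word_space.lin_comb_add word_space.lin_comb_diff
      word_space.lin_comb_word_scale)

lemmas lin_ext_simps = lin_ext_add lin_ext_diff lin_ext_scale lin_ext_zero lin_ext_basis_vec

text \<open>\<open>FN X\<close> is the case of all bracketed words; smaller sets record what is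
  known about every word in a support, such as alternation with a given neighbour.\<close>

definition span_words :: "'a word set \<Rightarrow> ('a word \<Rightarrow>\<^sub>0 'k::field) set" where
  "span_words S = {u. Poly_Mapping.keys u \<subseteq> S}"

lemma FN_eq_span_words: "FN X = span_words (bracketed_words X)"
  by (simp add: FN_def span_words_def)

lemma span_words_mono: "S \<subseteq> T \<Longrightarrow> span_words S \<subseteq> span_words T"
  by (auto simp: span_words_def)

lemma basis_vec_in_span_words [simp]: "basis_vec w \<in> span_words S \<longleftrightarrow> w \<in> S"
  by (simp add: span_words_def)

lemma subspace_span_words: "word_space.subspace (span_words S :: ('a word \<Rightarrow>\<^sub>0 'k::field) set)"
proof (rule word_space.subspaceI)
  fix u v :: "'a word \<Rightarrow>\<^sub>0 'k" and c :: 'k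
  show "u + v \<in> span_words S" if "u \<in> span_words S" "v \<in> span_words S"
    using that Poly_Mapping.keys_add[of u v] by (auto simp: span_words_def)
  show "word_scale c u \<in> span_words S" if "u \<in> span_words S"
    using that keys_word_scale[of c u] by (auto simp: span_words_def)
qed (simp add: span_words_def)

lemmas span_words_closed =
  word_space.subspace_0[OF subspace_span_words]
  word_space.subspace_add[OF subspace_span_words]
  word_space.subspace_diff[OF subspace_span_words]
  word_space.subspace_scale[OF subspace_span_words]

lemma lin_ext_basis_vec_id: "lin_ext basis_vec u = u"
proof (rule poly_mapping_eqI)
  fix w
  have "Poly_Mapping.lookup (lin_ext basis_vec u) w =
      (\<Sum>v\<in>Poly_Mapping.keys u. if v = w then Poly_Mapping.lookup u v else 0)"
    by (simp add: lin_ext_def lookup_sum lookup_basis_vec if_distrib cong: if_cong)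
  also have "\<dots> = Poly_Mapping.lookup u w"
    by (simp add: in_keys_iff)
  finally show "Poly_Mapping.lookup (lin_ext basis_vec u) w = Poly_Mapping.lookup u w" .
qed

text \<open>Membership is carried along in the \<open>scale\<close> and \<open>add\<close> cases
  because the laws of a target algebra hold only on its carrier.\<close>

lemma span_words_induct [consumes 1, case_names zero basis scale add]:
  assumes "u \<in> span_words S"
    and "P 0"
    and "\<And>w. w \<in> S \<Longrightarrow> P (basis_vec w)"
    and "\<And>c u. u \<in> span_words S \<Longrightarrow> P u \<Longrightarrow> P (word_scale c u)"
    and "\<And>u v. u \<in> span_words S \<Longrightarrow> v \<in> span_words S \<Longrightarrow> P u \<Longrightarrow> P v \<Longrightarrow> P (u + v)"
  shows "P u"
proof -
  let ?f = "\<lambda>w. word_scale (Poly_Mapping.lookup u w) (basis_vec w)"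
  \<comment> \<open>Induction over the partial sums of the expansion of \<open>u\<close> in basis
    words; membership is proved alongside because the \<open>add\<close> case asks for it.\<close>
  have "sum ?f T \<in> span_words S \<and> P (sum ?f T)" if "finite T" "T \<subseteq> S" for T
    using that
  proof (induction T)
    case empty
    show ?case
      by (simp add: assms(2) span_words_closed)
  next
    case (insert w T)
    then have "?f w \<in> span_words S" "P (?f w)"
      by (simp_all add: assms span_words_closed)
    with insert show ?case
      by (simp add: assms(5) span_words_closed)
  qed
  from this[of "Poly_Mapping.keys u"] assms(1) show ?thesis
    by (simp add: span_words_def flip: lin_ext_def) (simp add: lin_ext_basis_vec_id)
qed

lemma lin_ext_in_span_words:
  "u \<in> span_words S \<Longrightarrow> (\<And>w. w \<in> S \<Longrightarrow> g w \<in> span_words T) \<Longrightarrow> lin_ext g u \<in> span_words T"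
  unfolding lin_ext_eq_lin_comb
  by (intro word_space.lin_comb_in_subspace subspace_span_words) (auto simp: span_words_def)

text \<open>The product and concatenation are both of this form, so one set of bilinearity rules
  serves both.\<close>

definition bilin_ext ::
  "('a word \<Rightarrow> 'a word \<Rightarrow> ('a word \<Rightarrow>\<^sub>0 'k::field)) \<Rightarrow> ('a word \<Rightarrow>\<^sub>0 'k) \<Rightarrow> ('a word \<Rightarrow>\<^sub>0 'k) \<Rightarrow>
   ('a word \<Rightarrow>\<^sub>0 'k)" where
  "bilin_ext B u v = lin_ext (\<lambda>x. lin_ext (B x) v) u"

lemma bilin_ext_add_left: "bilin_ext B (u + u') v = bilin_ext B u v + bilin_ext B u' v"
  and bilin_ext_diff_left: "bilin_ext B (u - u') v = bilin_ext B u v - bilin_ext B u' v"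
  and bilin_ext_scale_left: "bilin_ext B (word_scale c u) v = word_scale c (bilin_ext B u v)"
  and bilin_ext_zero_left: "bilin_ext B 0 v = 0"
  by (simp_all add: bilin_ext_def lin_ext_simps)

lemma bilin_ext_add_right: "bilin_ext B u (v + v') = bilin_ext B u v + bilin_ext B u v'"
  and bilin_ext_scale_right: "bilin_ext B u (word_scale c v) = word_scale c (bilin_ext B u v)"
  by (simp_all add: bilin_ext_def lin_ext_simps)
    (simp_all add: lin_ext_eq_lin_comb word_space.lin_comb_fun_add word_space.lin_comb_fun_scale)

lemma bilin_ext_zero_right: "bilin_ext B u 0 = 0"
  using bilin_ext_scale_right[of B u 0 0] by simp

lemma bilin_ext_diff_right: "bilin_ext B u (v - v') = bilin_ext B u v - bilin_ext B u v'"
  using bilin_ext_add_right[of B u "v - v'" v'] by simp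

lemma bilin_ext_basis_vec: "bilin_ext B (basis_vec x) (basis_vec y) = B x y"
  by (simp add: bilin_ext_def lin_ext_simps)

lemmas bilin_ext_simps =
  bilin_ext_add_left bilin_ext_diff_left bilin_ext_scale_left bilin_ext_zero_left
  bilin_ext_add_right bilin_ext_diff_right bilin_ext_scale_right bilin_ext_zero_right
  bilin_ext_basis_vec

lemma bilin_ext_in_span_words:
  assumes "\<And>x y. x \<in> S \<Longrightarrow> y \<in> T \<Longrightarrow> B x y \<in> span_words R" "u \<in> span_words S" "v \<in> span_words T"
  shows "bilin_ext B u v \<in> span_words R"
  unfolding bilin_ext_def using assms by (intro lin_ext_in_span_words) auto

definition conc :: "('a word \<Rightarrow>\<^sub>0 'k::field) \<Rightarrow> ('a word \<Rightarrow>\<^sub>0 'k) \<Rightarrow> ('a word \<Rightarrow>\<^sub>0 'k)" where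
  "conc = bilin_ext (\<lambda>x y. basis_vec (x @ y))"

lemmas conc_simps = bilin_ext_simps[of "\<lambda>x y. basis_vec (x @ y)", folded conc_def]

lemma diamond_eq_bilin_ext: "diamond s m X = bilin_ext (word_prod s m X)"
  by (intro ext)
    (simp add: diamond_def bilin_ext_def lin_ext_def word_space.scale_sum_right)

lemma NA_basis_vec [simp]: "NA (basis_vec w) = basis_vec (bracket w)"
  and NA_add: "NA (u + v) = NA u + NA v"
  and NA_diff: "NA (u - v) = NA u - NA v"
  and NA_scale: "NA (word_scale c u) = word_scale c (NA u)"
  and NA_zero [simp]: "NA 0 = 0"
  by (simp_all add: NA_def lin_ext_simps)

lemma NA_in_span_words: "u \<in> span_words S \<Longrightarrow> NA u \<in> span_words (bracket ` S)"
  unfolding NA_def by (rule lin_ext_in_span_words) auto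

section \<open>The product on words\<close>

locale nijenhuis_construction = nonunital_algebra scale carrier mult
  for scale :: "'k::field \<Rightarrow> 'a::ab_group_add \<Rightarrow> 'a" (infixr "*s" 75)
    and carrier :: "'a set"
    and mult :: "'a \<Rightarrow> 'a \<Rightarrow> 'a" (infixl "\<cdot>" 70) +
  fixes X :: "'a set"
  assumes independent_X: "independent X" and span_X: "span X = carrier"
begin

abbreviation words :: "'a word set" where
  "words \<equiv> bracketed_words X"

abbreviation wprod :: "'a word \<Rightarrow> 'a word \<Rightarrow> ('a word \<Rightarrow>\<^sub>0 'k)" where
  "wprod \<equiv> word_prod scale mult X"

abbreviation dprod :: "('a word \<Rightarrow>\<^sub>0 'k) \<Rightarrow> ('a word \<Rightarrow>\<^sub>0 'k) \<Rightarrow> ('a word \<Rightarrow>\<^sub>0 'k)" (infixl "\<diamondop>" 70) where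
  "u \<diamondop> v \<equiv> diamond scale mult X u v"

abbreviation incl :: "'a \<Rightarrow> ('a word \<Rightarrow>\<^sub>0 'k)" where
  "incl \<equiv> jA scale X"

lemmas dprod_simps = bilin_ext_simps[of wprod, folded diamond_eq_bilin_ext]

section \<open>Coefficients and linearity of the embedding\<close>

lemma lookup_incl_letter: "Poly_Mapping.lookup (incl a) [Gen x] = representation X a x"
proof -
  have "Poly_Mapping.lookup (incl a) [Gen x] =
      (\<Sum>y | representation X a y \<noteq> 0. if y = x then representation X a y else 0)"
    by (simp add: jA_def lookup_sum lookup_basis_vec if_distrib cong: if_cong)
  also have "\<dots> = representation X a x"
    by (simp add: finite_representation)
  finally show ?thesis .
qed

lemma lookup_incl_other: "(\<And>x. w \<noteq> [Gen x]) \<Longrightarrow> Poly_Mapping.lookup (incl a) w = 0"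
  unfolding jA_def lookup_sum by (rule sum.neutral) (auto simp: lookup_basis_vec)

lemma incl_eqI:
  assumes "\<And>x. representation X a x = Poly_Mapping.lookup u [Gen x]"
    and "Poly_Mapping.keys u \<subseteq> range (\<lambda>x. [Gen x])"
  shows "incl a = u"
proof (rule poly_mapping_eqI)
  fix w
  show "Poly_Mapping.lookup (incl a) w = Poly_Mapping.lookup u w"
  proof (cases "w \<in> range (\<lambda>x. [Gen x])")
    case True
    then show ?thesis
      by (auto simp: lookup_incl_letter assms(1))
  next
    case False
    then have "w \<notin> Poly_Mapping.keys u"
      using assms(2) by auto
    then have "Poly_Mapping.lookup u w = 0"
      by (simp add: in_keys_iff)
    moreover have "Poly_Mapping.lookup (incl a) w = 0"
      using False by (intro lookup_incl_other) auto
    ultimately show ?thesis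
      by simp
  qed
qed

lemma keys_incl: "Poly_Mapping.keys (incl a) \<subseteq> range (\<lambda>x. [Gen x])"
proof
  fix w assume "w \<in> Poly_Mapping.keys (incl a)"
  then have "Poly_Mapping.lookup (incl a) w \<noteq> 0"
    by (simp add: in_keys_iff)
  then show "w \<in> range (\<lambda>x. [Gen x])"
    using lookup_incl_other[of w a] by blast
qed

lemma incl_add: "a \<in> carrier \<Longrightarrow> b \<in> carrier \<Longrightarrow> incl (a + b) = incl a + incl b"
proof (rule incl_eqI)
  show "Poly_Mapping.keys (incl a + incl b) \<subseteq> range (\<lambda>x. [Gen x])"
    by (rule order_trans[OF Poly_Mapping.keys_add]) (simp add: keys_incl)
qed (simp add: lookup_add lookup_incl_letter representation_add[OF independent_X] span_X)

lemma incl_scale: "a \<in> carrier \<Longrightarrow> incl (c *s a) = word_scale c (incl a)"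
proof (rule incl_eqI)
  show "Poly_Mapping.keys (word_scale c (incl a)) \<subseteq> range (\<lambda>x. [Gen x])"
    by (rule order_trans[OF keys_word_scale keys_incl])
qed (simp add: lookup_incl_letter representation_scale[OF independent_X] span_X)

lemma incl_zero: "incl 0 = 0"
  using incl_scale[of 0 0] subspace_0[OF subspace_carrier] by simp

lemma incl_basis: "x \<in> X \<Longrightarrow> incl x = basis_vec [Gen x]"
  by (intro incl_eqI) (simp_all add: lookup_basis_vec representation_basis[OF independent_X])

lemma incl_in_span_words: "incl a \<in> span_words (letters X)"
  unfolding jA_def
  by (intro word_space.subspace_sum[OF subspace_span_words] span_words_closed)
    (auto dest: representation_ne_zero)

lemma X_subset_carrier: "x \<in> X \<Longrightarrow> x \<in> carrier"
  using span_base[of x X] span_X by simp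

section \<open>Recursion equations for the product of words\<close>

lemma breadth_letter: "x \<in> X \<Longrightarrow> breadth X [Gen x] = 1"
  and breadth_bracket: "w \<in> words \<Longrightarrow> breadth X (bracket w) = 1"
  by (simp_all add: breadth_def std_decomp_letter std_decomp_bracket)

lemmas word_simps = letter_in_bracketed_words bracket_in_bracketed_words breadth_letter breadth_bracket

lemma wprod_letters: "x \<in> X \<Longrightarrow> y \<in> X \<Longrightarrow> wprod [Gen x] [Gen y] = incl (x \<cdot> y)"
  by (subst word_prod.simps) (simp add: word_simps)

lemma wprod_letter_bracket:
  "x \<in> X \<Longrightarrow> w \<in> words \<Longrightarrow> wprod [Gen x] (bracket w) = basis_vec ([Gen x] @ bracket w)"
  by (subst word_prod.simps) (simp add: word_simps)

lemma wprod_bracket_letter: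
  "x \<in> X \<Longrightarrow> w \<in> words \<Longrightarrow> wprod (bracket w) [Gen x] = basis_vec (bracket w @ [Gen x])"
  by (subst word_prod.simps) (simp add: word_simps)

lemma wprod_brackets:
  "v \<in> words \<Longrightarrow> w \<in> words \<Longrightarrow> wprod (bracket v) (bracket w) =
     NA (wprod (bracket v) w) + NA (wprod v (bracket w)) - NA (NA (wprod v w))"
  by (subst word_prod.simps) (simp add: word_simps)

text \<open>For two words of breadth one the outer concatenations are empty and the formula returns
  the product itself, so the general clause holds without a case distinction on breadth.\<close>

lemma wprod_eq_lin_ext:
  assumes "x \<in> words" "y \<in> words"
  shows "wprod x y =
    lin_ext (\<lambda>w. basis_vec (concat (butlast (std_decomp X x)) @ w @ concat (tl (std_decomp X y))))
      (wprod (last (std_decomp X x)) (hd (std_decomp X y)))"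
proof (cases "breadth X x = 1 \<and> breadth X y = 1")
  case True
  have *: "std_decomp X w = [w]" if "w \<in> words" "breadth X w = 1" for w
  proof -
    obtain c where "std_decomp X w = [c]"
      using \<open>breadth X w = 1\<close> by (auto simp: breadth_def length_Suc_conv)
    with concat_std_decomp[OF \<open>w \<in> words\<close>] show ?thesis
      by simp
  qed
  with True assms show ?thesis
    by (simp add: lin_ext_basis_vec_id)
next
  case False
  show ?thesis
    by (subst word_prod.simps) (simp only: assms False simp_thms if_False)
qed

lemma conc_basis_lin_ext: "conc (basis_vec u) (lin_ext g p) = lin_ext (\<lambda>w. conc (basis_vec u) (g w)) p"
  and conc_lin_ext_basis: "conc (lin_ext g p) (basis_vec u) = lin_ext (\<lambda>w. conc (g w) (basis_vec u)) p"
proof -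
  have "p \<in> span_words UNIV"
    by (simp add: span_words_def)
  then have "conc (basis_vec u) (lin_ext g p) = lin_ext (\<lambda>w. conc (basis_vec u) (g w)) p \<and>
      conc (lin_ext g p) (basis_vec u) = lin_ext (\<lambda>w. conc (g w) (basis_vec u)) p"
    by (induction rule: span_words_induct) (simp_all add: lin_ext_simps conc_simps)
  then show "conc (basis_vec u) (lin_ext g p) = lin_ext (\<lambda>w. conc (basis_vec u) (g w)) p"
    "conc (lin_ext g p) (basis_vec u) = lin_ext (\<lambda>w. conc (g w) (basis_vec u)) p"
    by simp_all
qed

text \<open>The last component of \<open>u @ x\<close> is that of \<open>x\<close>, so the junction
  with \<open>y\<close> is unchanged and \<open>u\<close> merely stays in front.\<close>

lemma wprod_append_left:
  assumes "u \<in> words" "x \<in> words" "y \<in> words" "joinable u x"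
  shows "wprod (u @ x) y = conc (basis_vec u) (wprod x y)"
  using assms
  by (simp add: wprod_eq_lin_ext[of "u @ x" y] wprod_eq_lin_ext[of x y] append_in_bracketed_words
      std_decomp_append std_decomp_neq_Nil butlast_append concat_std_decomp conc_basis_lin_ext conc_simps)

lemma wprod_append_right:
  assumes "x \<in> words" "y \<in> words" "v \<in> words" "joinable y v"
  shows "wprod x (y @ v) = conc (wprod x y) (basis_vec v)"
  using assms
  by (simp add: wprod_eq_lin_ext[of x "y @ v"] wprod_eq_lin_ext[of x y] append_in_bracketed_words
      std_decomp_append std_decomp_neq_Nil concat_std_decomp conc_lin_ext_basis conc_simps)

text \<open>Letter times bracket and bracket times letter are concatenations by definition. Peeling
  outer components leads back to these, as \<open>joinable\<close> rules out two components of the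
  same kind at the junction.\<close>

lemma wprod_joinable:
  assumes "u \<in> words" "v \<in> words" "joinable u v"
  shows "wprod u v = basis_vec (u @ v)"
  using assms
proof (induction "length u + length v" arbitrary: u v rule: less_induct)
  case less
  note ne = bracketed_words_nonempty[where X = X]
  show ?case
    using less.prems(1)
  proof (cases rule: bracketed_words_cases)
    case u: (append c u')
    then have "wprod u' v = basis_vec (u' @ v)"
      using less.prems ne[of u'] ne[OF component_in_bracketed_words[of c X]]
      by (intro less.hyps) simp_all
    with u less.prems show ?thesis
      by (simp add: wprod_append_left component_in_bracketed_words conc_simps)
  next
    case u: (letter x)
    show ?thesis
      using less.prems(2)
    proof (cases rule: bracketed_words_cases)
      case v: (append c v')
      then have "wprod u c = basis_vec (u @ c)"
        using less.prems ne[of v'] ne[OF component_in_bracketed_words[of c X]]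
        by (intro less.hyps) (simp_all add: component_in_bracketed_words joinable_def)
      with v less.prems show ?thesis
        by (simp add: wprod_append_right component_in_bracketed_words conc_simps)
    qed (use u less.prems in \<open>simp_all add: joinable_def wprod_letter_bracket[simplified]\<close>)
  next
    case u: (bracket w)
    show ?thesis
      using less.prems(2)
    proof (cases rule: bracketed_words_cases)
      case v: (append c v')
      then have "wprod u c = basis_vec (u @ c)"
        using less.prems ne[of v'] ne[OF component_in_bracketed_words[of c X]]
        by (intro less.hyps) (simp_all add: component_in_bracketed_words joinable_def)
      with v less.prems show ?thesis
        by (simp add: wprod_append_right component_in_bracketed_words conc_simps)
    qed (use u less.prems in \<open>simp_all add: joinable_def wprod_bracket_letter\<close>)
  qed
qed

text \<open>The case rule for inductions on products. Mixed pairs of components are absorbed into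
  \<open>joinable\<close>, which leaves two components of the same kind once nothing can be split
  off.\<close>

lemma word_pair_cases:
  assumes "x \<in> words" "y \<in> words"
  obtains (left) c v where "c \<in> words" "v \<in> words" "joinable c v" "x = c @ v"
    | (right) c v where "c \<in> words" "v \<in> words" "joinable c v" "y = c @ v"
    | (joinable) "joinable x y"
    | (letters) a b where "a \<in> X" "b \<in> X" "x = [Gen a]" "y = [Gen b]"
    | (brackets) v w where "v \<in> words" "w \<in> words" "x = bracket v" "y = bracket w"
  using assms(1)
proof (cases rule: bracketed_words_cases)
  case x: (letter a)
  show ?thesis
    using assms(2)
  proof (cases rule: bracketed_words_cases)
    case (letter b)
    with x show ?thesis
      by (intro letters[of a b])
  next
    case (bracket w)
    with x show ?thesis
      by (intro joinable) (simp add: joinable_def)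
  next
    case (append c v)
    with component_in_bracketed_words[OF append(1)] show ?thesis
      by (intro right[of c v])
  qed
next
  case x: (bracket u)
  show ?thesis
    using assms(2)
  proof (cases rule: bracketed_words_cases)
    case (letter b)
    with x show ?thesis
      by (intro joinable) (simp add: joinable_def)
  next
    case (bracket w)
    with x show ?thesis
      by (intro brackets[of u w])
  next
    case (append c v)
    with component_in_bracketed_words[OF append(1)] show ?thesis
      by (intro right[of c v])
  qed
next
  case (append c v)
  with component_in_bracketed_words[OF append(1)] show ?thesis
    by (intro left[of c v])
qed

text \<open>The invariant of the product: words in the support of \<open>wprod x y\<close> begin
  like \<open>x\<close> and end like \<open>y\<close>, so whatever alternates with \<open>x\<close>
  on the left or with \<open>y\<close> on the right still alternates with each of them.\<close>

definition ends_as :: "'a word \<Rightarrow> 'a word \<Rightarrow> 'a word set" where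
  "ends_as x y = {w \<in> words. is_letter (hd w) = is_letter (hd x) \<and> is_letter (last w) = is_letter (last y)}"

lemma ends_as_append_left:
  assumes "c \<in> words" "joinable c v" "w \<in> ends_as v y"
  shows "c @ w \<in> ends_as (c @ v) y"
  using assms bracketed_words_nonempty[of c X] bracketed_words_nonempty[of w X]
  by (simp add: ends_as_def joinable_def append_in_bracketed_words)

lemma ends_as_append_right:
  assumes "v \<in> words" "joinable c v" "w \<in> ends_as x c"
  shows "w @ v \<in> ends_as x (c @ v)"
  using assms bracketed_words_nonempty[of v X] bracketed_words_nonempty[of w X]
  by (simp add: ends_as_def joinable_def append_in_bracketed_words)

lemma wprod_in_ends_as:
  assumes "x \<in> words" "y \<in> words"
  shows "wprod x y \<in> span_words (ends_as x y)"
  using assms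
proof (induction "length x + length y" arbitrary: x y rule: less_induct)
  case less
  note ne = bracketed_words_nonempty[where X = X]
  from less.prems show ?case
  proof (cases rule: word_pair_cases)
    case (left c v)
    then have "wprod v y \<in> span_words (ends_as v y)"
      using less.prems ne[of c] by (intro less.hyps) simp_all
    then have "conc (basis_vec c) (wprod v y) \<in> span_words (ends_as (c @ v) y)"
      unfolding conc_def using left
      by (intro bilin_ext_in_span_words[of "{c}" "ends_as v y"]) (auto intro: ends_as_append_left)
    with left less.prems show ?thesis
      by (simp add: wprod_append_left)
  next
    case (right c v)
    then have "wprod x c \<in> span_words (ends_as x c)"
      using less.prems ne[of v] by (intro less.hyps) simp_all
    then have "conc (wprod x c) (basis_vec v) \<in> span_words (ends_as x (c @ v))"
      unfolding conc_def using right
      by (intro bilin_ext_in_span_words[of "ends_as x c" "{v}"]) (auto intro: ends_as_append_right)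
    with right less.prems show ?thesis
      by (simp add: wprod_append_right)
  next
    case joinable
    with less.prems show ?thesis
      using ne[of x] ne[of y] by (simp add: wprod_joinable ends_as_def append_in_bracketed_words)
  next
    case (letters a b)
    have "letters X \<subseteq> ends_as x y"
      using letters by (auto simp: ends_as_def letters_def letter_in_bracketed_words)
    from subsetD[OF span_words_mono[OF this] incl_in_span_words] letters show ?thesis
      by (simp add: wprod_letters)
  next
    case (brackets v w)
    have b: "bracket v \<in> words" "bracket w \<in> words"
      using brackets by (simp_all add: bracket_in_bracketed_words)
    \<comment> \<open>All three terms are images under \<open>NA\<close>, so their words begin and
      end with a bracket symbol; of the inner products only membership in \<open>words\<close>
      matters.\<close>
    have sub: "bracket ` words \<subseteq> ends_as x y"
      using brackets by (auto simp: ends_as_def bracket_in_bracketed_words)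
    have sub': "ends_as x' y' \<subseteq> words" for x' y'
      by (auto simp: ends_as_def)
    have bw: "bracket ` words \<subseteq> words"
      by (auto simp: bracket_in_bracketed_words)
    have NA_words: "NA u \<in> span_words words" if "u \<in> span_words words" for u :: "'a word \<Rightarrow>\<^sub>0 'k"
      using subsetD[OF span_words_mono[OF bw] NA_in_span_words[OF that]] .
    have NA_ends: "NA u \<in> span_words (ends_as x y)" if "u \<in> span_words words" for u
      using subsetD[OF span_words_mono[OF sub] NA_in_span_words[OF that]] .
    have "wprod x' y' \<in> span_words words" if "x' \<in> words" "y' \<in> words"
      "length x' + length y' < length x + length y" for x' y'
      using subsetD[OF span_words_mono[OF sub'] less.hyps[OF that(3,1,2)]] .
    then have "wprod (bracket v) w \<in> span_words words" "wprod v (bracket w) \<in> span_words words"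
      "wprod v w \<in> span_words words"
      using brackets b by simp_all
    then have "NA (wprod (bracket v) w) + NA (wprod v (bracket w)) - NA (NA (wprod v w))
        \<in> span_words (ends_as x y)"
      by (intro span_words_closed NA_ends NA_words)
    with brackets show ?thesis
      by (simp add: wprod_brackets)
  qed
qed

section \<open>Associativity and the Nijenhuis identity\<close>

lemma conc_left_dprod:
  assumes "u \<in> words" "p \<in> span_words {w \<in> words. joinable u w}" "q \<in> span_words words"
  shows "conc (basis_vec u) p \<diamondop> q = conc (basis_vec u) (p \<diamondop> q)"
  using assms(2)
proof (induction rule: span_words_induct)
  case (basis w)
  show ?case
    using assms(3) by (induction rule: span_words_induct)
      (use basis assms(1) in \<open>simp_all add: conc_simps dprod_simps wprod_append_left\<close>)
qed (simp_all add: conc_simps dprod_simps)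

lemma dprod_conc_right:
  assumes "v \<in> words" "p \<in> span_words {w \<in> words. joinable w v}" "q \<in> span_words words"
  shows "q \<diamondop> conc p (basis_vec v) = conc (q \<diamondop> p) (basis_vec v)"
  using assms(2)
proof (induction rule: span_words_induct)
  case (basis w)
  show ?case
    using assms(3) by (induction rule: span_words_induct)
      (use basis assms(1) in \<open>simp_all add: conc_simps dprod_simps wprod_append_right\<close>)
qed (simp_all add: conc_simps dprod_simps)

text \<open>Here \<open>q\<close> meets only \<open>v\<close>, so whatever stands before
  \<open>v\<close> is untouched. Together with its mirror image \<open>dprod_conc_left\<close> this
  separates the two junctions of a middle factor that can be split.\<close>

lemma conc_right_dprod:
  assumes "v \<in> words" "p \<in> span_words {w \<in> words. joinable w v}" "q \<in> span_words words"
  shows "conc p (basis_vec v) \<diamondop> q = conc p (basis_vec v \<diamondop> q)"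
  using assms(2)
proof (induction rule: span_words_induct)
  case (basis w)
  show ?case
    using assms(3) by (induction rule: span_words_induct)
      (use basis assms(1) in \<open>simp_all add: conc_simps dprod_simps wprod_append_left\<close>)
qed (simp_all add: conc_simps dprod_simps)

lemma dprod_conc_left:
  assumes "u \<in> words" "p \<in> span_words {w \<in> words. joinable u w}" "q \<in> span_words words"
  shows "q \<diamondop> conc (basis_vec u) p = conc (q \<diamondop> basis_vec u) p"
  using assms(2)
proof (induction rule: span_words_induct)
  case (basis w)
  show ?case
    using assms(3) by (induction rule: span_words_induct)
      (use basis assms(1) in \<open>simp_all add: conc_simps dprod_simps wprod_append_right\<close>)
qed (simp_all add: conc_simps dprod_simps)

lemma dprod_joinable_left:
  assumes "u \<in> words" "p \<in> span_words {w \<in> words. joinable u w}"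
  shows "basis_vec u \<diamondop> p = conc (basis_vec u) p"
  using assms(2) by (induction rule: span_words_induct)
    (use assms(1) in \<open>simp_all add: conc_simps dprod_simps wprod_joinable\<close>)

lemma dprod_joinable_right:
  assumes "v \<in> words" "p \<in> span_words {w \<in> words. joinable w v}"
  shows "p \<diamondop> basis_vec v = conc p (basis_vec v)"
  using assms(2) by (induction rule: span_words_induct)
    (use assms(1) in \<open>simp_all add: conc_simps dprod_simps wprod_joinable\<close>)

lemma wprod_in_span_words: "x \<in> words \<Longrightarrow> y \<in> words \<Longrightarrow> wprod x y \<in> span_words words"
  by (rule subsetD[OF span_words_mono wprod_in_ends_as]) (simp_all add: ends_as_def)

text \<open>Supplies the side condition of the concatenation rules when their argument is a product
  instead of a single word.\<close>

lemma wprod_joinable_left: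
  assumes "x \<in> words" "y \<in> words" "joinable c x"
  shows "wprod x y \<in> span_words {w \<in> words. joinable c w}"
  by (rule subsetD[OF span_words_mono wprod_in_ends_as[OF assms(1,2)]])
    (use assms(3) in \<open>auto simp: ends_as_def joinable_def\<close>)

lemma wprod_joinable_right:
  assumes "x \<in> words" "y \<in> words" "joinable y c"
  shows "wprod x y \<in> span_words {w \<in> words. joinable w c}"
  by (rule subsetD[OF span_words_mono wprod_in_ends_as[OF assms(1,2)]])
    (use assms(3) in \<open>auto simp: ends_as_def joinable_def\<close>)

lemma dprod_in_span_words:
  "p \<in> span_words words \<Longrightarrow> q \<in> span_words words \<Longrightarrow> p \<diamondop> q \<in> span_words words"
  unfolding diamond_eq_bilin_ext by (rule bilin_ext_in_span_words) (auto intro: wprod_in_span_words)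

lemma NA_in_span_bracketed_words: "p \<in> span_words words \<Longrightarrow> NA p \<in> span_words words"
  by (rule subsetD[OF span_words_mono NA_in_span_words])
    (auto simp: bracket_in_bracketed_words)


end

section \<open>Zero and closure laws on a carrier\<close>

context nonunital_algebra
begin

lemma zero_in_carrier: "0 \<in> carrier"
  by (rule subspace_0[OF subspace_carrier])

lemma mult_zero_left: "a \<in> carrier \<Longrightarrow> 0 \<cdot> a = 0"
  using mult_scale_left[of 0 a 0] zero_in_carrier by simp

lemma mult_zero_right: "a \<in> carrier \<Longrightarrow> a \<cdot> 0 = 0"
  using mult_scale_right[of a 0 0] zero_in_carrier by simp

lemmas carrier_closed =
  zero_in_carrier subspace_add[OF subspace_carrier] subspace_scale[OF subspace_carrier] mult_closed

end

lemma (in nijenhuis_algebra) P_zero: "P 0 = 0"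
  using P_scale[of 0 0] zero_in_carrier by simp

context nijenhuis_construction
begin

text \<open>Additivity of \<open>incl\<close> and of the multiplication is available only on the
  carrier, so the induction hands over membership of \<open>b\<close> as well.\<close>

lemma carrier_induct [consumes 1, case_names zero step]:
  assumes "a \<in> carrier" and "P 0"
    and "\<And>c x b. x \<in> X \<Longrightarrow> b \<in> carrier \<Longrightarrow> P b \<Longrightarrow> P (c *s x + b)"
  shows "P a"
proof -
  have "a \<in> span X"
    using assms(1) span_X by simp
  then have "a \<in> carrier \<and> P a"
    by (induction rule: span_induct_alt) (simp_all add: assms carrier_closed X_subset_carrier)
  then show ?thesis ..
qed

text \<open>The product on words refers to the multiplication of \<open>A\<close> only on basis
  elements; linearity in each argument carries this over to the whole carrier.\<close>

lemma incl_mult: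
  assumes "a \<in> carrier" "b \<in> carrier"
  shows "incl (a \<cdot> b) = incl a \<diamondop> incl b"
  using assms(1)
proof (induction rule: carrier_induct)
  case zero
  show ?case
    using assms(2) by (simp add: mult_zero_left incl_zero dprod_simps)
next
  case (step c x a)
  note x = step.hyps(1) X_subset_carrier[OF step.hyps(1)]
  have "incl (x \<cdot> b) = incl x \<diamondop> incl b"
    using assms(2)
  proof (induction rule: carrier_induct)
    case zero
    show ?case
      using x by (simp add: mult_zero_right incl_zero dprod_simps)
  next
    case (step d y b)
    note y = step.hyps(1) X_subset_carrier[OF step.hyps(1)]
    have "incl (x \<cdot> y) = incl x \<diamondop> incl y"
      using x y by (simp add: incl_basis dprod_simps wprod_letters)
    with step x y show ?case
      by (simp add: mult_add_right mult_scale_right carrier_closed incl_add incl_scale dprod_simps)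
  qed
  with step x assms(2) show ?case
    by (simp add: mult_add_left mult_scale_left carrier_closed incl_add incl_scale dprod_simps)
qed

text \<open>On basis words this is the defining clause for two brackets, and both sides are
  bilinear.\<close>

lemma NA_dprod_NA:
  assumes "p \<in> span_words words" "q \<in> span_words words"
  shows "NA p \<diamondop> NA q = NA (NA p \<diamondop> q) + NA (p \<diamondop> NA q) - NA (NA (p \<diamondop> q))"
  using assms(1)
proof (induction rule: span_words_induct)
  case (basis v)
  show ?case
    using assms(2)
  proof (induction rule: span_words_induct)
    case (basis w)
    with \<open>v \<in> words\<close> show ?case
      by (simp add: dprod_simps wprod_brackets)
  qed (simp_all add: dprod_simps NA_add NA_diff NA_scale
      word_space.scale_right_distrib word_space.scale_right_diff_distrib)
qed (simp_all add: dprod_simps NA_add NA_diff NA_scale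
    word_space.scale_right_distrib word_space.scale_right_diff_distrib)

text \<open>
  Expanding with the Nijenhuis identity and using associativity wherever at most two of the factors
  are in the image of \<open>NA\<close> turns both sides into the same expression.
\<close>

lemma dprod_assoc_brackets:
  assumes mem: "p \<in> span_words words" "q \<in> span_words words" "r \<in> span_words words"
    and assoc: "(p \<diamondop> q) \<diamondop> r = p \<diamondop> (q \<diamondop> r)"
      "(NA p \<diamondop> q) \<diamondop> r = NA p \<diamondop> (q \<diamondop> r)"
      "(p \<diamondop> NA q) \<diamondop> r = p \<diamondop> (NA q \<diamondop> r)"
      "(p \<diamondop> q) \<diamondop> NA r = p \<diamondop> (q \<diamondop> NA r)"
      "(NA p \<diamondop> NA q) \<diamondop> r = NA p \<diamondop> (NA q \<diamondop> r)"
      "(NA p \<diamondop> q) \<diamondop> NA r = NA p \<diamondop> (q \<diamondop> NA r)"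
      "(p \<diamondop> NA q) \<diamondop> NA r = p \<diamondop> (NA q \<diamondop> NA r)"
  shows "(NA p \<diamondop> NA q) \<diamondop> NA r = NA p \<diamondop> (NA q \<diamondop> NA r)"
proof -
  note nij = NA_dprod_NA and lin = dprod_simps(1,2,5,6) NA_add NA_diff
  note closed = mem dprod_in_span_words NA_in_span_bracketed_words span_words_closed
  \<comment> \<open>The common value of both sides: for each nonempty choice of k factors left
    without \<open>NA\<close>, the right-nested product is wrapped in k copies of \<open>NA\<close>
    and carries the sign \<open>(-1)^(k-1)\<close>.\<close>
  let ?S = "NA (NA p \<diamondop> (NA q \<diamondop> r)) + NA (NA p \<diamondop> (q \<diamondop> NA r)) + NA (p \<diamondop> (NA q \<diamondop> NA r))
    - NA (NA (NA p \<diamondop> (q \<diamondop> r))) - NA (NA (p \<diamondop> (NA q \<diamondop> r))) - NA (NA (p \<diamondop> (q \<diamondop> NA r)))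
    + NA (NA (NA (p \<diamondop> (q \<diamondop> r))))"
  \<comment> \<open>Expanding the left side leaves terms such as
    \<open>NA (NA (NA p \<diamondop> q) \<diamondop> r)\<close>, with an operator around a partial
    product. Regrouping the first term of \<open>?S\<close> and expanding
    \<open>NA p \<diamondop> NA q\<close> produces those that survive cancellation.\<close>
  have exp_left: "NA (NA p \<diamondop> (NA q \<diamondop> r)) = NA (NA (NA p \<diamondop> q) \<diamondop> r) + NA (NA (p \<diamondop> NA q) \<diamondop> r)
      - NA (NA (NA (p \<diamondop> q)) \<diamondop> r)"
    unfolding assoc(5)[symmetric] by (simp only: nij mem lin)
  have exp_right: "NA (p \<diamondop> (NA q \<diamondop> NA r)) = NA (p \<diamondop> NA (NA q \<diamondop> r)) + NA (p \<diamondop> NA (q \<diamondop> NA r))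
      - NA (p \<diamondop> NA (NA (q \<diamondop> r)))"
    by (simp only: nij mem lin)
  have "(NA p \<diamondop> NA q) \<diamondop> NA r =
      NA (NA p \<diamondop> q) \<diamondop> NA r + NA (p \<diamondop> NA q) \<diamondop> NA r - NA (NA (p \<diamondop> q)) \<diamondop> NA r"
    by (simp only: nij mem lin)
  also have "\<dots> = ?S"
    unfolding exp_left by (simp add: nij closed lin assoc algebra_simps)
  also have "\<dots> = NA p \<diamondop> NA (NA q \<diamondop> r) + NA p \<diamondop> NA (q \<diamondop> NA r) - NA p \<diamondop> NA (NA (q \<diamondop> r))"
    unfolding exp_right by (simp add: nij closed lin algebra_simps)
  also have "\<dots> = NA p \<diamondop> (NA q \<diamondop> NA r)"
    by (simp only: nij mem lin)
  finally show ?thesis .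
qed

text \<open>An alternating junction turns the product there into concatenation, and a middle word
  that can be split keeps the two junctions apart. Once the outer words are peeled as well, all
  three are single components of the same kind: letters, where associativity in the carrier applies,
  or brackets.\<close>

lemma wprod_assoc:
  assumes "x \<in> words" "y \<in> words" "z \<in> words"
  shows "wprod x y \<diamondop> basis_vec z = basis_vec x \<diamondop> wprod y z"
  using assms
proof (induction "length x + length y + length z" arbitrary: x y z rule: less_induct)
  case less
  note ne = bracketed_words_nonempty[where X = X]
  have peel_left: ?case if c: "c \<in> words" "v \<in> words" "joinable c v" "x = c @ v" for c v
  proof -
    have "wprod x y \<diamondop> basis_vec z = conc (basis_vec c) (wprod v y \<diamondop> basis_vec z)"
      using less.prems c by (simp add: wprod_append_left conc_left_dprod wprod_joinable_left)
    also have "wprod v y \<diamondop> basis_vec z = basis_vec v \<diamondop> wprod y z"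
      using less.prems c ne[of c] by (intro less.hyps) simp_all
    also have "conc (basis_vec c) (basis_vec v \<diamondop> wprod y z) = conc (basis_vec c) (basis_vec v) \<diamondop> wprod y z"
      using less.prems c by (intro conc_left_dprod[symmetric]) (simp_all add: wprod_in_span_words)
    finally show ?case
      using c by (simp add: conc_simps)
  qed
  have peel_right: ?case if c: "c \<in> words" "v \<in> words" "joinable c v" "z = c @ v" for c v
  proof -
    have "wprod x y \<diamondop> basis_vec z = wprod x y \<diamondop> conc (basis_vec c) (basis_vec v)"
      using c by (simp add: conc_simps)
    also have "\<dots> = conc (wprod x y \<diamondop> basis_vec c) (basis_vec v)"
      using less.prems c by (intro dprod_conc_right) (simp_all add: wprod_in_span_words)
    also have "wprod x y \<diamondop> basis_vec c = basis_vec x \<diamondop> wprod y c"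
      using less.prems c ne[of v] by (intro less.hyps) simp_all
    also have "conc (basis_vec x \<diamondop> wprod y c) (basis_vec v) = basis_vec x \<diamondop> wprod y z"
      using less.prems c by (simp add: wprod_append_right dprod_conc_right wprod_joinable_right)
    finally show ?case .
  qed
  \<comment> \<open>The products with \<open>x\<close> and with \<open>z\<close> take place at
    different junctions, so no induction hypothesis is needed.\<close>
  have peel_middle: ?case if c: "c \<in> words" "v \<in> words" "joinable c v" "y = c @ v" for c v
  proof -
    have "wprod x y \<diamondop> basis_vec z = conc (wprod x c) (basis_vec v \<diamondop> basis_vec z)"
      using less.prems c by (simp add: wprod_append_right conc_right_dprod wprod_joinable_right)
    also have "\<dots> = conc (basis_vec x \<diamondop> basis_vec c) (wprod v z)"
      by (simp add: dprod_simps)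
    also have "\<dots> = basis_vec x \<diamondop> wprod y z"
      using less.prems c
      by (simp add: wprod_append_left dprod_conc_left wprod_joinable_left)
    finally show ?case .
  qed
  have joinable_left: ?case if "joinable x y"
  proof -
    have "wprod x y \<diamondop> basis_vec z = conc (basis_vec x) (basis_vec y) \<diamondop> basis_vec z"
      using less.prems that by (simp add: wprod_joinable conc_simps)
    also have "\<dots> = conc (basis_vec x) (wprod y z)"
      using less.prems that by (subst conc_left_dprod) (simp_all add: dprod_simps)
    also have "\<dots> = basis_vec x \<diamondop> wprod y z"
      using less.prems that by (simp add: dprod_joinable_left wprod_joinable_left)
    finally show ?thesis .
  qed
  have joinable_right: ?case if "joinable y z"
  proof -
    have "wprod x y \<diamondop> basis_vec z = conc (wprod x y) (basis_vec z)"
      using less.prems that by (simp add: dprod_joinable_right wprod_joinable_right)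
    also have "\<dots> = basis_vec x \<diamondop> conc (basis_vec y) (basis_vec z)"
      using less.prems that by (subst dprod_conc_right) (simp_all add: dprod_simps)
    also have "\<dots> = basis_vec x \<diamondop> wprod y z"
      using less.prems that by (simp add: wprod_joinable conc_simps)
    finally show ?thesis .
  qed
  from less.prems(1,2) show ?case
  proof (cases rule: word_pair_cases)
    case xy: (letters a b)
    from less.prems(2,3) show ?thesis
    proof (cases rule: word_pair_cases)
      case yz: (letters b' c)
      have "incl (a \<cdot> b) \<diamondop> incl c = incl a \<diamondop> incl (b \<cdot> c)"
        using xy(1,2) yz(2) by (simp add: X_subset_carrier mult_assoc carrier_closed flip: incl_mult)
      with xy yz show ?thesis
        by (simp add: wprod_letters incl_basis)
    qed (use xy peel_middle peel_right joinable_right in \<open>simp_all\<close>)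
  next
    case xy: (brackets u v)
    from less.prems(2,3) show ?thesis
    proof (cases rule: word_pair_cases)
      case yz: (brackets v' w)
      \<comment> \<open>Each associativity hypothesis of \<open>dprod_assoc_brackets\<close>
        concerns a triple of words with at least one bracket removed, hence of smaller total
        length.\<close>
      have assoc: "(basis_vec a \<diamondop> basis_vec b) \<diamondop> basis_vec c = basis_vec a \<diamondop> (basis_vec b \<diamondop> basis_vec c)"
        if "a \<in> words" "b \<in> words" "c \<in> words"
          "length a + length b + length c < length x + length y + length z" for a b c
        using less.hyps[OF that(4,1-3)] by (simp add: dprod_simps)
      have "(NA (basis_vec u) \<diamondop> NA (basis_vec v)) \<diamondop> NA (basis_vec w) =
          NA (basis_vec u) \<diamondop> (NA (basis_vec v) \<diamondop> NA (basis_vec w))"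
        by (rule dprod_assoc_brackets)
          (use xy yz in \<open>simp_all add: assoc bracket_in_bracketed_words\<close>)
      with xy yz show ?thesis
        by (simp add: dprod_simps)
    qed (use xy peel_middle peel_right joinable_right in \<open>simp_all\<close>)
  qed (fact peel_left peel_middle joinable_left)+
qed

lemma dprod_assoc:
  assumes "p \<in> span_words words" "q \<in> span_words words" "r \<in> span_words words"
  shows "(p \<diamondop> q) \<diamondop> r = p \<diamondop> (q \<diamondop> r)"
  using assms(1)
proof (induction rule: span_words_induct)
  case x: (basis x)
  show ?case
    using assms(2)
  proof (induction rule: span_words_induct)
    case y: (basis y)
    show ?case
      using assms(3) by (induction rule: span_words_induct)
        (use x y in \<open>simp_all add: dprod_simps wprod_assoc\<close>)
  qed (simp_all add: dprod_simps)
qed (simp_all add: dprod_simps)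

lemma nonunital_algebra_FN: "nonunital_algebra word_scale (FN X) (diamond scale mult X)"
  unfolding FN_eq_span_words
  by (intro nonunital_algebra.intro nonunital_algebra_axioms.intro)
    (simp_all add: vector_space_word_scale subspace_span_words dprod_in_span_words
      dprod_simps dprod_assoc)

lemma nijenhuis_algebra_FN: "nijenhuis_algebra word_scale (FN X) (diamond scale mult X) NA"
proof (intro nijenhuis_algebra.intro nonunital_algebra_FN nijenhuis_algebra_axioms.intro)
qed (simp_all add: FN_eq_span_words NA_in_span_bracketed_words NA_add NA_scale NA_dprod_NA)

lemma algebra_hom_incl:
  "algebra_hom scale carrier mult word_scale (FN X) (diamond scale mult X) incl"
proof -
  have "incl a \<in> FN X" for a
    unfolding FN_eq_span_words
    by (rule subsetD[OF span_words_mono incl_in_span_words])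
      (auto simp: letters_def letter_in_bracketed_words)
  then show ?thesis
    by (simp add: algebra_hom_def incl_add incl_scale incl_mult)
qed

end

section \<open>The universal property\<close>

locale nijenhuis_lift =
  nijenhuis_construction scale carrier mult X +
  N: nijenhuis_algebra scaleN N multN P
  for scale :: "'k::field \<Rightarrow> 'a::ab_group_add \<Rightarrow> 'a" (infixr "*s" 75)
    and carrier :: "'a set"
    and mult :: "'a \<Rightarrow> 'a \<Rightarrow> 'a" (infixl "\<cdot>" 70)
    and X :: "'a set"
    and scaleN :: "'k \<Rightarrow> 'n::ab_group_add \<Rightarrow> 'n"
    and N :: "'n set"
    and multN :: "'n \<Rightarrow> 'n \<Rightarrow> 'n" (infixl "\<odot>" 70)
    and P :: "'n \<Rightarrow> 'n" +
  fixes f :: "'a \<Rightarrow> 'n"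
  assumes hom_f: "algebra_hom scale carrier mult scaleN N multN f"
begin

text \<open>Splitting off only the first component makes the recursion deterministic;
  \<open>word_lift_append\<close> later allows any alternating split. The value 0 outside
  \<open>words\<close> is a mere default.\<close>

function word_lift :: "'a word \<Rightarrow> 'n" where
  "word_lift w =
     (if w \<notin> words then 0
      else if w \<in> letters X then f (letter_of w)
      else if breadth X w = 1 then P (word_lift (unbracket w))
      else word_lift (hd (std_decomp X w)) \<odot> word_lift (concat (tl (std_decomp X w))))"
  by pat_completeness auto
termination
proof (relation "measure length", goal_cases)
  case 1
  show ?case by simp
next
  case (2 w)
  then show ?case
    using bracketed_words_nonempty[of w X] by (simp add: length_unbracket)
next
  case (3 w)
  then have "w \<in> words" by simp
  with 3 show ?case
    using length_less_std_decomp[OF _ std_decomp_ends(1)] by simp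
next
  case (4 w)
  then have w: "w \<in> words" by simp
  obtain c cs where d: "std_decomp X w = c # cs"
    using std_decomp_neq_Nil[OF w] by (cases "std_decomp X w") simp_all
  have "c \<noteq> []"
    using set_std_decomp[OF w] d by (intro component_nonempty[of c X]) simp
  moreover have "length w = length c + length (concat cs)"
    using concat_std_decomp[OF w] d by (metis concat.simps(2) length_append)
  ultimately show ?case
    by (simp add: d)
qed

declare word_lift.simps [simp del]

lemma word_lift_letter: "x \<in> X \<Longrightarrow> word_lift [Gen x] = f x"
  by (subst word_lift.simps) (simp add: word_simps)

lemma word_lift_bracket: "w \<in> words \<Longrightarrow> word_lift (bracket w) = P (word_lift w)"
  by (subst word_lift.simps) (simp add: word_simps)

lemma word_lift_component_append:
  assumes "c \<in> letters X \<union> bracket ` words" "v \<in> words" "joinable c v"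
  shows "word_lift (c @ v) = word_lift c \<odot> word_lift v"
proof -
  have c: "c \<in> words" "c \<noteq> []"
    using assms(1) component_in_bracketed_words component_nonempty by blast+
  have d: "std_decomp X (c @ v) = c # std_decomp X v"
    using assms c by (simp add: std_decomp_append std_decomp_component)
  then have "breadth X (c @ v) \<noteq> 1"
    using std_decomp_neq_Nil[OF assms(2)] by (simp add: breadth_def)
  moreover have "c @ v \<notin> letters X"
    using c(2) bracketed_words_nonempty[OF assms(2)] by (auto simp: letters_def append_eq_Cons_conv)
  ultimately show ?thesis
    using c(1) assms(2,3)
    by (subst word_lift.simps) (simp add: d append_in_bracketed_words concat_std_decomp)
qed

lemma f_closed: "a \<in> carrier \<Longrightarrow> f a \<in> N"
  and f_add: "a \<in> carrier \<Longrightarrow> b \<in> carrier \<Longrightarrow> f (a + b) = f a + f b"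
  and f_scale: "a \<in> carrier \<Longrightarrow> f (c *s a) = scaleN c (f a)"
  and f_mult: "a \<in> carrier \<Longrightarrow> b \<in> carrier \<Longrightarrow> f (a \<cdot> b) = f a \<odot> f b"
  using hom_f by (simp_all add: algebra_hom_def)

lemma f_zero: "f 0 = 0"
  using f_scale[of 0 0] zero_in_carrier by simp

lemma word_lift_closed: "w \<in> words \<Longrightarrow> word_lift w \<in> N"
proof (induction "length w" arbitrary: w rule: less_induct)
  case less
  from less.prems show ?case
  proof (cases rule: bracketed_words_cases)
    case (letter x)
    then show ?thesis
      by (simp add: word_lift_letter f_closed X_subset_carrier)
  next
    case (bracket v)
    then show ?thesis
      using less.hyps[of v] by (simp add: word_lift_bracket N.P_closed)
  next
    case (append c v)
    then show ?thesis
      using less.hyps[of c] less.hyps[of v] bracketed_words_nonempty[of v X]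
        component_in_bracketed_words[of c X] component_nonempty[of c X]
      by (simp add: word_lift_component_append N.mult_closed)
  qed
qed

text \<open>The recursion splits after the first component only; associativity in \<open>N\<close>
  moves the split to any alternating junction.\<close>

lemma word_lift_append:
  assumes "u \<in> words" "v \<in> words" "joinable u v"
  shows "word_lift (u @ v) = word_lift u \<odot> word_lift v"
  using assms
proof (induction "length u" arbitrary: u rule: less_induct)
  case less
  from less.prems(1) show ?case
  proof (cases rule: bracketed_words_cases)
    case (append c w)
    have c: "c \<in> words" "c \<noteq> []" "w \<noteq> []"
      using append component_in_bracketed_words component_nonempty bracketed_words_nonempty by blast+
    then have "word_lift (w @ v) = word_lift w \<odot> word_lift v"
      using less.prems append by (intro less.hyps) simp_all
    with append c less.prems show ?thesis
      by (simp add: word_lift_component_append append_in_bracketed_words word_lift_closed N.mult_assoc)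
  qed (use less.prems word_lift_component_append[of u v] in simp_all)
qed

section \<open>Linear extension and its compatibility with the operations\<close>

definition lift :: "('a word \<Rightarrow>\<^sub>0 'k) \<Rightarrow> 'n" where
  "lift = lin_comb scaleN word_lift"

lemma lift_add: "lift (p + q) = lift p + lift q"
  and lift_diff: "lift (p - q) = lift p - lift q"
  and lift_scale: "lift (word_scale c p) = scaleN c (lift p)"
  and lift_zero: "lift 0 = 0"
  and lift_basis_vec: "lift (basis_vec w) = word_lift w"
  by (simp_all add: lift_def N.lin_comb_add N.lin_comb_diff N.lin_comb_word_scale)

lemmas lift_simps = lift_add lift_diff lift_scale lift_zero lift_basis_vec

lemma lift_closed: "p \<in> span_words words \<Longrightarrow> lift p \<in> N"
  unfolding lift_def by (intro N.lin_comb_in_subspace N.subspace_carrier word_lift_closed)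
    (auto simp: span_words_def)

lemma lift_closed_subset: "p \<in> span_words S \<Longrightarrow> S \<subseteq> words \<Longrightarrow> lift p \<in> N"
  using lift_closed span_words_mono[of S words] by blast

lemma lift_conc_left:
  assumes "u \<in> words" "p \<in> span_words {w \<in> words. joinable u w}"
  shows "lift (conc (basis_vec u) p) = word_lift u \<odot> lift p"
  using assms(2)
proof (induction rule: span_words_induct)
  case zero
  show ?case
    using assms(1) by (simp add: conc_simps lift_simps word_lift_closed N.mult_zero_right)
qed (use assms(1) in \<open>simp_all add: conc_simps lift_simps word_lift_append word_lift_closed
    N.mult_scale_right N.mult_add_right lift_closed_subset\<close>)

lemma lift_conc_right:
  assumes "u \<in> words" "p \<in> span_words {w \<in> words. joinable w u}"
  shows "lift (conc p (basis_vec u)) = lift p \<odot> word_lift u"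
  using assms(2)
proof (induction rule: span_words_induct)
  case zero
  show ?case
    using assms(1) by (simp add: conc_simps lift_simps word_lift_closed N.mult_zero_left)
qed (use assms(1) in \<open>simp_all add: conc_simps lift_simps word_lift_append word_lift_closed
    N.mult_scale_left N.mult_add_left lift_closed_subset\<close>)

lemma lift_incl: "a \<in> carrier \<Longrightarrow> lift (incl a) = f a"
  by (induction rule: carrier_induct)
    (simp_all add: incl_zero lift_simps f_zero incl_add incl_scale incl_basis word_lift_letter
      f_add f_scale X_subset_carrier carrier_closed)

lemma lift_NA: "p \<in> span_words words \<Longrightarrow> lift (NA p) = P (lift p)"
  by (induction rule: span_words_induct)
    (simp_all add: lift_simps N.P_zero NA_add NA_scale word_lift_bracket N.P_add N.P_scale lift_closed)

text \<open>Peeling reduces to single components, where the three kinds of junction are settled by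
  \<open>word_lift_append\<close>, by multiplicativity of \<open>f\<close>, and by the Nijenhuis
  identity in \<open>N\<close>.\<close>

lemma lift_wprod:
  assumes "x \<in> words" "y \<in> words"
  shows "lift (wprod x y) = word_lift x \<odot> word_lift y"
  using assms
proof (induction "length x + length y" arbitrary: x y rule: less_induct)
  case less
  note ne = bracketed_words_nonempty[where X = X]
  from less.prems show ?case
  proof (cases rule: word_pair_cases)
    case (left c v)
    then have "lift (wprod v y) = word_lift v \<odot> word_lift y"
      using less.prems ne[of c] by (intro less.hyps) simp_all
    with left less.prems show ?thesis
      by (simp add: wprod_append_left lift_conc_left wprod_joinable_left word_lift_append
          word_lift_closed N.mult_assoc)
  next
    case (right c v)
    then have "lift (wprod x c) = word_lift x \<odot> word_lift c"
      using less.prems ne[of v] by (intro less.hyps) simp_all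
    with right less.prems show ?thesis
      by (simp add: wprod_append_right lift_conc_right wprod_joinable_right word_lift_append
          word_lift_closed N.mult_assoc)
  next
    case joinable
    with less.prems show ?thesis
      by (simp add: wprod_joinable lift_simps word_lift_append)
  next
    case (letters a b)
    then show ?thesis
      by (simp add: wprod_letters lift_incl word_lift_letter X_subset_carrier carrier_closed f_mult)
  next
    case (brackets v w)
    \<comment> \<open>Each inner pair is shorter in total. As \<open>lift\<close> turns
      \<open>NA\<close> into \<open>P\<close>, the defining clause for brackets becomes the right
      side of the identity in \<open>N\<close>.\<close>
    have "lift (wprod (bracket v) w) = word_lift (bracket v) \<odot> word_lift w"
      "lift (wprod v (bracket w)) = word_lift v \<odot> word_lift (bracket w)"
      "lift (wprod v w) = word_lift v \<odot> word_lift w"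
      using brackets by (intro less.hyps; simp add: bracket_in_bracketed_words)+
    with brackets show ?thesis
      by (simp add: wprod_brackets lift_simps lift_NA wprod_in_span_words bracket_in_bracketed_words
          NA_in_span_bracketed_words word_lift_bracket N.nijenhuis word_lift_closed)
  qed
qed

lemma lift_dprod:
  assumes "p \<in> span_words words" "q \<in> span_words words"
  shows "lift (p \<diamondop> q) = lift p \<odot> lift q"
  using assms(1)
proof (induction rule: span_words_induct)
  case (basis x)
  show ?case
    using assms(2) by (induction rule: span_words_induct)
      (use basis in \<open>simp_all add: dprod_simps lift_simps lift_wprod word_lift_closed lift_closed
        N.mult_zero_right N.mult_scale_right N.mult_add_right\<close>)
qed (use assms(2) in \<open>simp_all add: dprod_simps lift_simps lift_closed
  N.mult_zero_left N.mult_scale_left N.mult_add_left\<close>)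

lemma nijenhuis_hom_lift:
  "nijenhuis_hom word_scale (FN X) (diamond scale mult X) NA scaleN N multN P (restrict lift (FN X))"
  by (simp add: nijenhuis_hom_def algebra_hom_def FN_eq_span_words span_words_closed lift_simps
      lift_closed lift_dprod dprod_in_span_words lift_NA NA_in_span_bracketed_words)

text \<open>Concatenation at an alternating junction is a product, so every word arises from letters
  by \<open>NA\<close> and products, and a homomorphism has no freedom on basis words.\<close>

lemma nijenhuis_hom_eq_lift:
  assumes g: "nijenhuis_hom word_scale (FN X) (diamond scale mult X) NA scaleN N multN P g"
    and incl: "\<And>a. a \<in> carrier \<Longrightarrow> g (incl a) = f a"
    and "p \<in> span_words words"
  shows "g p = lift p"
proof -
  have g_add: "g (p + q) = g p + g q" if "p \<in> span_words words" "q \<in> span_words words" for p q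
    using g that by (simp add: nijenhuis_hom_def algebra_hom_def FN_eq_span_words)
  have g_scale: "g (word_scale c p) = scaleN c (g p)" if "p \<in> span_words words" for c p
    using g that by (simp add: nijenhuis_hom_def algebra_hom_def FN_eq_span_words)
  have g_mult: "g (p \<diamondop> q) = g p \<odot> g q" if "p \<in> span_words words" "q \<in> span_words words" for p q
    using g that by (simp add: nijenhuis_hom_def algebra_hom_def FN_eq_span_words)
  have g_NA: "g (NA p) = P (g p)" if "p \<in> span_words words" for p
    using g that by (simp add: nijenhuis_hom_def FN_eq_span_words)
  have word: "g (basis_vec w) = word_lift w" if "w \<in> words" for w
    using that
  proof (induction "length w" arbitrary: w rule: less_induct)
    case less
    from less.prems show ?case
    proof (cases rule: bracketed_words_cases)
      case (letter x)
      then show ?thesis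
        using incl[of x] by (simp add: incl_basis X_subset_carrier word_lift_letter)
    next
      case (bracket v)
      then show ?thesis
        using less.hyps[of v] g_NA[of "basis_vec v"] by (simp add: word_lift_bracket)
    next
      case (append c v)
      have c: "c \<in> words" "c \<noteq> []" "v \<noteq> []"
        using append component_in_bracketed_words component_nonempty bracketed_words_nonempty by blast+
      then show ?thesis
        using append less.hyps[of c] less.hyps[of v] g_mult[of "basis_vec c" "basis_vec v"]
        by (simp add: dprod_simps wprod_joinable word_lift_append)
    qed
  qed
  have g_zero: "g 0 = 0"
    using g_scale[of 0 0] by (simp add: span_words_closed)
  show ?thesis
    using assms(3) by (induction rule: span_words_induct)
      (simp_all add: lift_simps word g_zero g_add g_scale)
qed

text \<open>Being a homomorphism constrains a function on \<open>FN X\<close> only;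
  \<open>extensional\<close> fixes its values elsewhere, so that uniqueness is equality of functions
  on the whole type.\<close>

lemma ex1_nijenhuis_hom:
  "\<exists>!g. g \<in> extensional (FN X) \<and>
     nijenhuis_hom word_scale (FN X) (diamond scale mult X) NA scaleN N multN P g \<and>
     (\<forall>a\<in>carrier. g (incl a) = f a)"
proof (rule ex1I)
  have "incl a \<in> FN X" if "a \<in> carrier" for a
    using algebra_hom_incl that by (simp add: algebra_hom_def)
  then show "restrict lift (FN X) \<in> extensional (FN X) \<and>
     nijenhuis_hom word_scale (FN X) (diamond scale mult X) NA scaleN N multN P (restrict lift (FN X)) \<and>
     (\<forall>a\<in>carrier. restrict lift (FN X) (incl a) = f a)"
    by (simp add: nijenhuis_hom_lift lift_incl)
next
  fix g
  assume "g \<in> extensional (FN X) \<and>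
     nijenhuis_hom word_scale (FN X) (diamond scale mult X) NA scaleN N multN P g \<and>
     (\<forall>a\<in>carrier. g (incl a) = f a)"
  then have "g \<in> extensional (FN X)" and "\<And>p. p \<in> FN X \<Longrightarrow> g p = restrict lift (FN X) p"
    using nijenhuis_hom_eq_lift by (simp_all add: FN_eq_span_words)
  then show "g = restrict lift (FN X)"
    by (rule extensionalityI[OF _ restrict_extensional])
qed

end

theorem theorem2p4:
  fixes scaleA :: "'k::field \<Rightarrow> 'a::ab_group_add \<Rightarrow> 'a"
    and A :: "'a set"
    and multA :: "'a \<Rightarrow> 'a \<Rightarrow> 'a"
    and X :: "'a set"
  assumes algebra_A: "nonunital_algebra scaleA A multA"
    and basis_X: "\<not> module.dependent scaleA X" "module.span scaleA X = A"
  shows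
    "nonunital_algebra word_scale (FN X) (diamond scaleA multA X) \<and>
     nijenhuis_algebra word_scale (FN X) (diamond scaleA multA X) NA \<and>
     algebra_hom scaleA A multA word_scale (FN X) (diamond scaleA multA X) (jA scaleA X) \<and>
     (\<forall>(scaleN :: 'k \<Rightarrow> 'n::ab_group_add \<Rightarrow> 'n) N multN P f.
       nijenhuis_algebra scaleN N multN P \<and> algebra_hom scaleA A multA scaleN N multN f \<longrightarrow>
       (\<exists>!fbar. fbar \<in> extensional (FN X) \<and>
          nijenhuis_hom word_scale (FN X) (diamond scaleA multA X) NA scaleN N multN P fbar \<and>
          (\<forall>a\<in>A. fbar (jA scaleA X a) = f a)))"
proof -
  have con: "nijenhuis_construction scaleA A multA X"
    using assms by (simp add: nijenhuis_construction_def nijenhuis_construction_axioms_def)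
  have "\<exists>!fbar. fbar \<in> extensional (FN X) \<and>
          nijenhuis_hom word_scale (FN X) (diamond scaleA multA X) NA scaleN N multN P fbar \<and>
          (\<forall>a\<in>A. fbar (jA scaleA X a) = f a)"
    if "nijenhuis_algebra scaleN N multN P" "algebra_hom scaleA A multA scaleN N multN f"
    for scaleN :: "'k \<Rightarrow> 'n \<Rightarrow> 'n" and N multN P f
    using that con
    by (intro nijenhuis_lift.ex1_nijenhuis_hom nijenhuis_lift.intro nijenhuis_lift_axioms.intro)
  with con show ?thesis
    by (simp add: nijenhuis_construction.nonunital_algebra_FN nijenhuis_construction.nijenhuis_algebra_FN
        nijenhuis_construction.algebra_hom_incl)
qed

end
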